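(* Let $F : \mathbb{N} \rightarrow \mathbb{N}$ be a nondecreasing function for which there exist $c,\epsilon > 0$ such that for all $n \in \mathbb{N}$, $$F(n) \geq \exp\big( c\, n \log (n)^2 \log\log (n)^{1+\epsilon} \big).$$ Then there exists a residually finite group $G$, generated by a finite set $S$, and $c_1, c_2, c_3 > 1$ such that $$F(n/c_1 - c_2)^{1 - c_3 \frac{\log\log\log F(n)}{\log\log F(n)}} \leq \mathcal{R}_G^S(n) \leq F(c_1 n + c_2)^{\left(2 + c_3 \frac{\log(n)}{\log\log F(n)}\right) n}$$ for all $n \in \mathbb{N}$.
   Context: For a function $F:\mathbb{N}\to\mathbb{N}$ and $x\in(0,\infty)$ not an integer, $F(x)$ means $F(\lceil x\rceil)$. A group $G$ is residually finite if for every nontrivial $g\in G$ there is a finite-index subgroup of $G$ not containing $g$. For $G$ generated by a finite set $S$, let $B_S(n)=\{s_1\cdots s_m : 0\le m\le n,\ s_i\in S\cup S^{-1}\}$. The injectivity radius of a finite-index subgroup $H\le G$ is the maximal $n$ for which the restriction to $B_S(n)$ of the coset map $G\to G/H$, $g\mapsto gH$, is injective (or $+\infty$ if the set of such $n$ is unbounded). The full residual finiteness growth function (also called residual girth) $\mathcal{R}_G^S:\mathbb{N}\to\mathbb{N}$ is defined by letting $\mathcal{R}_G^S(n)$ be the minimal index of a finite-index normal subgroup of $G$ of injectivity radius at least $n$.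
   Formalization: The upper bound is claimed only for n with F(n) ≥ 3 (loglog F(n) is undefined for F(n) ≤ 1; for F(3) = 2 the bound fails at n = 3 since c_3 > 1), and the lower bound only for n with n/c_1 − c_2 ≥ 0, where F(n/c_1 − c_2) is defined. *)

theory Defs
  imports Complex_Main "HOL-Library.Extended_Nat" "HOL-Algebra.Algebra"
begin

text \<open>
  The value of \<open>F : \<nat> \<rightarrow> \<nat>\<close> at a real argument \<open>x \<ge> 0\<close>, namely \<open>F \<lceil>x\<rceil>\<close>.
  It is only meaningful for \<open>x \<ge> 0\<close> (\<open>nat\<close> truncates negative integers to \<open>0\<close>).
\<close>

definition at_real :: "(nat \<Rightarrow> nat) \<Rightarrow> real \<Rightarrow> nat" where
  "at_real F x = F (nat \<lceil>x\<rceil>)"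

definition finite_index :: "('a, 'b) monoid_scheme \<Rightarrow> 'a set \<Rightarrow> bool" where
  "finite_index G H \<longleftrightarrow> subgroup H G \<and> finite (lcosets\<^bsub>G\<^esub> H)"

definition residually_finite :: "('a, 'b) monoid_scheme \<Rightarrow> bool" where
  "residually_finite G \<longleftrightarrow>
     (\<forall>g \<in> carrier G. g \<noteq> \<one>\<^bsub>G\<^esub> \<longrightarrow> (\<exists>H. finite_index G H \<and> g \<notin> H))"

definition word_ball :: "('a, 'b) monoid_scheme \<Rightarrow> 'a set \<Rightarrow> nat \<Rightarrow> 'a set" where
  "word_ball G S n =
     {foldr (\<otimes>\<^bsub>G\<^esub>) w \<one>\<^bsub>G\<^esub> | w. length w \<le> n \<and> set w \<subseteq> S \<union> m_inv G ` S}"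

text \<open>
  The supremum is over a nonempty (it contains \<open>0\<close>), downward closed set, so in \<open>enat\<close> it is
  the maximum of that set, or \<open>\<infinity>\<close> if the set is unbounded.
\<close>

definition injectivity_radius ::
  "('a, 'b) monoid_scheme \<Rightarrow> 'a set \<Rightarrow> 'a set \<Rightarrow> enat" where
  "injectivity_radius G S H =
     Sup {enat n | n. inj_on (\<lambda>g. g <#\<^bsub>G\<^esub> H) (word_ball G S n)}"

text \<open>
  For \<open>G\<close> residually finite and generated by the finite set \<open>S\<close>, the set minimised over is
  nonempty.
\<close>

definition full_rf_growth :: "('a, 'b) monoid_scheme \<Rightarrow> 'a set \<Rightarrow> nat \<Rightarrow> nat" where
  "full_rf_growth G S n =
     (LEAST k. \<exists>N. N \<lhd> G \<and> finite_index G N \<and> enat n \<le> injectivity_radius G S N \<and>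
                    k = card (lcosets\<^bsub>G\<^esub> N))"

end

theory Submission
  imports Defs "HOL-Real_Asymp.Real_Asymp" "HOL-Library.Countable_Set"
begin

section \<open>Permutations acting on layers\<close>

text \<open>
  A finitely generated group \<open>G\<close> acts on layers \<open>s = 0, 1, 2, ...\<close>; on layer \<open>s\<close> it acts like
  the wreath product of \<open>S\<^sub>3\<close> with the cyclic group of order \<open>m s\<close>, a multiple of \<open>2 ^ (s + 1)\<close>
  with \<open>3 ^ m s\<close> roughly \<open>F (2 ^ s)\<close>. The generators are the shift, a reflection at
  position \<open>0\<close> and a different reflection at position \<open>2 ^ s\<close>. Conjugating the second reflection by the
  \<open>2 ^ s\<close>-th power of the shift makes the two meet on layer \<open>s\<close>, and on no other layer because
  \<open>2 ^ s - 2 ^ s'\<close> is not divisible by \<open>2 ^ (s' + 1)\<close>. The resulting commutator has length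
  \<open>O(2 ^ s)\<close> and lies in a subgroup \<open>(\<int>/3) ^ m s\<close> of \<open>G\<close> that meets every normal subgroup
  avoiding the commutator trivially, which yields the lower bound. For the upper bound, on all layers with
  \<open>2 ^ s > 4 n\<close> a word of length \<open>2 n\<close> sees the same picture, so the first \<open>log n + O(1)\<close>
  layers already separate the ball of radius \<open>n\<close>.
\<close>

text \<open>
  A point is a layer, a position and an element of \<open>\<int>/3\<close>. Positions range over all integers;
  periodicity modulo \<open>m s\<close> is built into the action, so the shift has infinite order.
\<close>

type_synonym point = "nat \<times> int \<times> Enum.finite_3"

section \<open>Arithmetic in \<int>/3, the shift and the two reflections\<close>

lemma add_self_finite_3: "x + x = - (x :: Enum.finite_3)"
  by (cases x) (simp_all add: plus_finite_3_def uminus_finite_3_def)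

lemma nonzero_finite_3: "x \<noteq> 0 \<Longrightarrow> x = 1 \<or> x = - (1 :: Enum.finite_3)"
  by (cases x) (simp_all add: one_finite_3_def zero_finite_3_def uminus_finite_3_def)

definition shift :: "int \<Rightarrow> point \<Rightarrow> point" where
  "shift T = (\<lambda>(s, i, c). (s, i + T, c))"

lemma shift_apply [simp]: "shift T (s, i, c) = (s, i + T, c)"
  by (simp add: shift_def)

lemma shift_comp: "shift a \<circ> shift b = shift (a + b)"
  by (auto simp: shift_def fun_eq_iff)

lemma shift_zero: "shift 0 = id"
  by (auto simp: shift_def fun_eq_iff)

text \<open>The divisibility serves twice: it makes the period at least \<open>2 ^ Suc s\<close>,
  which keeps the marks \<open>0\<close> and \<open>2 ^ s\<close> of a layer apart, and it separates
  different layers in \<open>marks_separate\<close>.\<close>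

locale layered_action =
  fixes m :: "nat \<Rightarrow> nat"
  assumes m_pos: "m s > 0" and pow_dvd_m: "2 ^ Suc s dvd m s"
begin

abbreviation div_m :: "nat \<Rightarrow> int \<Rightarrow> bool" where
  "div_m s i \<equiv> int (m s) dvd i"

definition flip0 :: "point \<Rightarrow> point" where
  "flip0 = (\<lambda>(s, i, c). (s, i, if div_m s i then - c else c))"

definition flip1 :: "point \<Rightarrow> point" where
  "flip1 = (\<lambda>(s, i, c). (s, i, if div_m s (i - 2 ^ s) then 1 - c else c))"

lemma flip0_apply [simp]: "flip0 (s, i, c) = (s, i, if div_m s i then - c else c)"
  by (simp add: flip0_def)

lemma flip1_apply [simp]: "flip1 (s, i, c) = (s, i, if div_m s (i - 2 ^ s) then 1 - c else c)"
  by (simp add: flip1_def)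

lemma flip0_flip0: "flip0 \<circ> flip0 = id"
  by (auto simp: fun_eq_iff)

lemma flip1_flip1: "flip1 \<circ> flip1 = id"
  by (auto simp: fun_eq_iff)

section \<open>Words in the generators and the permutations they define\<close>

definition letters :: "(point \<Rightarrow> point) set" where
  "letters = {shift 1, shift (- 1), flip0, flip1}"

definition eval :: "(point \<Rightarrow> point) list \<Rightarrow> point \<Rightarrow> point" where
  "eval w = foldr (\<circ>) w id"

lemma eval_Nil [simp]: "eval [] = id"
  by (simp add: eval_def)

lemma eval_Cons [simp]: "eval (f # w) = f \<circ> eval w"
  by (simp add: eval_def)

lemma eval_append: "eval (v @ w) = eval v \<circ> eval w"
  by (induction v) (auto simp: comp_assoc)

text \<open>Words already form a group, because \<open>letters\<close> is closed under inverses: it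
  contains both unit shifts, and the flips are involutions.\<close>

definition perms :: "(point \<Rightarrow> point) set" where
  "perms = eval ` lists letters"

lemma countable_perms: "countable perms"
  unfolding perms_def by (intro countable_image countable_lists) (simp add: letters_def)

lemma perms_eval: "set w \<subseteq> letters \<Longrightarrow> eval w \<in> perms"
  unfolding perms_def by (auto simp: lists_eq_set)

lemma perms_cases:
  assumes "f \<in> perms"
  obtains w where "set w \<subseteq> letters" "f = eval w"
  using assms unfolding perms_def by (auto simp: lists_eq_set)

lemma id_perms: "id \<in> perms"
  using perms_eval[of "[]"] by (simp only: eval_Nil) simp

lemma letters_perms: "f \<in> letters \<Longrightarrow> f \<in> perms"
  using perms_eval[of "[f]"] by simp

lemma comp_perms: "f \<in> perms \<Longrightarrow> g \<in> perms \<Longrightarrow> f \<circ> g \<in> perms"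
  by (elim perms_cases) (metis eval_append perms_eval set_append Un_subset_iff)

lemma letters_inverse: "f \<in> letters \<Longrightarrow> \<exists>g\<in>letters. g \<circ> f = id \<and> f \<circ> g = id"
  using flip0_flip0 flip1_flip1 by (auto simp: letters_def shift_comp shift_zero)

lemma eval_inverse:
  assumes "set w \<subseteq> letters"
  obtains v where "set v \<subseteq> letters" "length v = length w" "eval v \<circ> eval w = id"
proof -
  have "\<exists>v. set v \<subseteq> letters \<and> length v = length w \<and> eval v \<circ> eval w = id"
    using assms
  proof (induction w)
    case Nil
    show ?case by (intro exI[of _ "[]"]) simp
  next
    case (Cons a w)
    then obtain v b where v: "set v \<subseteq> letters" "length v = length w" "eval v \<circ> eval w = id"
      and b: "b \<in> letters" "b \<circ> a = id"
      using letters_inverse by (metis insert_subset list.set(2))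
    have "eval (v @ [b]) \<circ> eval (a # w) = eval v \<circ> (b \<circ> a) \<circ> eval w"
      by (simp add: eval_append comp_assoc)
    also have "\<dots> = id" using v(3) b(2) by simp
    finally have "eval (v @ [b]) \<circ> eval (a # w) = id" .
    moreover have "set (v @ [b]) \<subseteq> letters" "length (v @ [b]) = length (a # w)" using v b by simp_all
    ultimately show ?case by blast
  qed
  then show thesis using that by blast
qed

lemma perms_inverse: "f \<in> perms \<Longrightarrow> \<exists>g\<in>perms. g \<circ> f = id"
  by (elim perms_cases) (metis eval_inverse perms_eval)

lemma shift_perms: "shift T \<in> perms"
proof -
  have nat: "shift (int n) \<in> perms \<and> shift (- int n) \<in> perms" for n
  proof (induction n)
    case 0
    show ?case using id_perms unfolding shift_zero[symmetric] by simp
  next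
    case (Suc n)
    have "shift (int (Suc n)) = shift 1 \<circ> shift (int n)"
      "shift (- int (Suc n)) = shift (- 1) \<circ> shift (- int n)"
      by (simp_all add: shift_comp)
    moreover have "shift 1 \<in> perms" "shift (- 1) \<in> perms"
      by (auto intro!: letters_perms simp: letters_def)
    ultimately show ?case using Suc comp_perms by metis
  qed
  show ?thesis using nat[of "nat T"] nat[of "nat (- T)"] by (cases "T \<ge> 0") auto
qed

text \<open>Each letter moves positions by the same amount on every layer, and whether it flips
  depends only on the position modulo \<open>m s\<close>; both properties survive composition. So a
  single \<open>\<tau>\<close> serves all layers.\<close>

lemma perms_form:
  assumes "f \<in> perms"
  obtains \<tau> h where "\<And>s i c. f (s, i, c) = (s, i + \<tau>, h s i c)"
    and "\<And>s i c T. div_m s T \<Longrightarrow> h s (i + T) c = h s i c"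
proof -
  from assms obtain w where w: "set w \<subseteq> letters" "f = eval w" by (elim perms_cases)
  have "set w \<subseteq> letters \<Longrightarrow> \<exists>\<tau> h. (\<forall>s i c. eval w (s, i, c) = (s, i + \<tau>, h s i c)) \<and>
      (\<forall>s i c T. div_m s T \<longrightarrow> h s (i + T) c = h s i c)"
  proof (induction w)
    case Nil
    show ?case by (rule exI[of _ 0], rule exI[of _ "\<lambda>s i c. c"]) auto
  next
    case (Cons a w)
    then obtain \<tau> h where h: "\<forall>s i c. eval w (s, i, c) = (s, i + \<tau>, h s i c)"
      "\<forall>s i c T. div_m s T \<longrightarrow> h s (i + T) c = h s i c" by auto
    have per: "div_m s (i + T + d) \<longleftrightarrow> div_m s (i + d)" if "div_m s T" for s i T d
    proof -
      have "i + T + d = (i + d) + T" by simp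
      then show ?thesis using that by (metis dvd_add_left_iff)
    qed
    consider "a = shift 1" | "a = shift (- 1)" | "a = flip0" | "a = flip1"
      using Cons.prems by (auto simp: letters_def)
    then show ?case
    proof cases
      case 1
      show ?thesis using h 1 by (intro exI[of _ "\<tau> + 1"] exI[of _ h]) auto
    next
      case 2
      show ?thesis using h 2 by (intro exI[of _ "\<tau> - 1"] exI[of _ h]) auto
    next
      case 3
      show ?thesis using h 3 per[of _ _ _ \<tau>]
        by (intro exI[of _ \<tau>] exI[of _ "\<lambda>s i c. if div_m s (i + \<tau>) then - h s i c else h s i c"]) auto
    next
      case 4
      have "div_m s (i + T + \<tau> - 2 ^ s) \<longleftrightarrow> div_m s (i + \<tau> - 2 ^ s)" if "div_m s T" for s i T
        using per[OF that, of i "\<tau> - 2 ^ s"] by (simp add: algebra_simps)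
      then show ?thesis using h 4
        by (intro exI[of _ \<tau>]
            exI[of _ "\<lambda>s i c. if div_m s (i + \<tau> - 2 ^ s) then 1 - h s i c else h s i c"]) auto
    qed
  qed
  then show thesis using that w by blast
qed

section \<open>Locality of the action\<close>

text \<open>The position drifts by at most the number of letters applied, so every test for a mark
  happens within distance \<open>r\<close> of the start. Equal patterns of marks there force equal
  behaviour.\<close>

lemma eval_local:
  assumes "set w \<subseteq> letters" "length w \<le> r"
    and "\<And>d. \<bar>d\<bar> \<le> int r \<Longrightarrow> div_m s (i + d) \<longleftrightarrow> div_m s' (i' + d)"
    and "\<And>d. \<bar>d\<bar> \<le> int r \<Longrightarrow> div_m s (i + d - 2 ^ s) \<longleftrightarrow> div_m s' (i' + d - 2 ^ s')"
  shows "\<exists>\<tau> c'. \<bar>\<tau>\<bar> \<le> int (length w) \<and> eval w (s, i, c) = (s, i + \<tau>, c') \<and>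
           eval w (s', i', c) = (s', i' + \<tau>, c')"
  using assms(1,2)
proof (induction w)
  case Nil
  show ?case by auto
next
  case (Cons a w)
  then obtain \<tau> c' where IH: "\<bar>\<tau>\<bar> \<le> int (length w)" "eval w (s, i, c) = (s, i + \<tau>, c')"
    "eval w (s', i', c) = (s', i' + \<tau>, c')" by auto
  have "\<bar>\<tau>\<bar> \<le> int r" using IH(1) Cons.prems by auto
  note eq = assms(3,4)[OF this]
  consider "a = shift 1" | "a = shift (- 1)" | "a = flip0" | "a = flip1"
    using Cons.prems by (auto simp: letters_def)
  then show ?case
  proof cases
    case 1
    show ?thesis using IH 1 by (intro exI[of _ "\<tau> + 1"]) auto
  next
    case 2
    show ?thesis using IH 2 by (intro exI[of _ "\<tau> - 1"]) auto
  next
    case 3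
    show ?thesis using IH 3 eq by (intro exI[of _ \<tau>]) auto
  next
    case 4
    show ?thesis using IH 4 eq by (intro exI[of _ \<tau>]) auto
  qed
qed

lemma m_ge: "2 ^ Suc s \<le> int (m s)"
proof -
  have "2 ^ Suc s \<le> m s" using dvd_imp_le[OF pow_dvd_m m_pos] .
  then show ?thesis by (metis of_nat_le_iff of_nat_numeral of_nat_power)
qed

lemma div_m_small: "div_m s d \<Longrightarrow> \<bar>d\<bar> < int (m s) \<Longrightarrow> d = 0"
  using dvd_imp_le_int[of d "int (m s)"] by auto

text \<open>
  Every point of a layer \<open>s \<ge> K\<close> has the same surroundings of radius \<open>r\<close> as some point of
  layer \<open>K\<close>, because the marked positions \<open>0\<close> and \<open>2 ^ s\<close> are further apart than \<open>2 * r\<close>.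
\<close>

lemma eval_determined_by_layer:
  assumes w: "set w \<subseteq> letters" "length w \<le> r" and K: "2 * r < 2 ^ K" and "K \<le> s"
    and triv: "\<And>i c. eval w (K, i, c) = (K, i, c)"
  shows "eval w (s, i, c) = (s, i, c)"
proof -
  have r2: "2 * int r < 2 ^ K"
    using K by (metis of_nat_less_iff of_nat_mult of_nat_numeral of_nat_power)
  have key: ?thesis
    if a: "\<And>d. \<bar>d\<bar> \<le> int r \<Longrightarrow> div_m s (i + d) \<longleftrightarrow> div_m K (i' + d)"
      and b: "\<And>d. \<bar>d\<bar> \<le> int r \<Longrightarrow> div_m s (i + d - 2 ^ s) \<longleftrightarrow> div_m K (i' + d - 2 ^ K)" for i'
  proof -
    obtain \<tau> c' where "eval w (s, i, c) = (s, i + \<tau>, c')" "eval w (K, i', c) = (K, i' + \<tau>, c')"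
      using eval_local[OF w a b] by blast
    then show ?thesis using triv[of i' c] by simp
  qed
  have big: "2 * int r < 2 ^ t \<and> 2 * 2 ^ t \<le> int (m t)" if "K \<le> t" for t
    using m_ge[of t] less_le_trans[OF r2 power_increasing[OF that, of "2::int"]] by simp
  have shift_div: "div_m t (i + d + e) \<longleftrightarrow> div_m t (d - d0 + e)" if "div_m t (i + d0)" for t i d d0 e
  proof -
    have "i + d + e = (i + d0) + (d - d0 + e)" by simp
    then show ?thesis using that by (metis dvd_add_right_iff)
  qed
  have near: "div_m t x \<longleftrightarrow> x = 0" if "K \<le> t" "\<bar>x\<bar> \<le> 2 * int r" for t x
    using div_m_small[of t x] big[OF that(1)] that(2) by auto
  have far: "\<not> div_m t (x + 2 ^ t) \<and> \<not> div_m t (x - 2 ^ t)" if "K \<le> t" "\<bar>x\<bar> \<le> 2 * int r" for t x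
  proof -
    have "x + 2 ^ t \<noteq> 0" "x - 2 ^ t \<noteq> 0" "\<bar>x + 2 ^ t\<bar> < int (m t)" "\<bar>x - 2 ^ t\<bar> < int (m t)"
      using big[OF that(1)] that(2) by linarith+
    then show ?thesis using div_m_small by blast
  qed
  \<comment> \<open>By \<open>key\<close> it remains to find \<open>i'\<close> on layer
    \<open>K\<close> with matching marks. If mark \<open>0\<close> or mark \<open>2 ^ s\<close> is
    within \<open>r\<close> of \<open>i\<close>, then \<open>i'\<close> gets the same offset from
    the corresponding mark of layer \<open>K\<close>; the other mark is out of reach on both
    layers.\<close>
  consider d0 where "\<bar>d0\<bar> \<le> int r" "div_m s (i + d0)"
    | d0 where "\<bar>d0\<bar> \<le> int r" "div_m s (i - 2 ^ s + d0)"
    | "\<forall>d. \<bar>d\<bar> \<le> int r \<longrightarrow> \<not> div_m s (i + d) \<and> \<not> div_m s (i + d - 2 ^ s)"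
    by (metis add_diff_eq diff_add_eq)
  then show ?thesis
  proof cases
    case 1
    show ?thesis
    proof (rule key[of "- d0"])
      fix d assume d: "\<bar>d\<bar> \<le> int r"
      show "div_m s (i + d) \<longleftrightarrow> div_m K (- d0 + d)"
        using shift_div[OF 1(2), of d 0] near[of s "d - d0"] near[of K "d - d0"] d 1(1) \<open>K \<le> s\<close>
        by (simp add: algebra_simps)
      show "div_m s (i + d - 2 ^ s) \<longleftrightarrow> div_m K (- d0 + d - 2 ^ K)"
        using shift_div[OF 1(2), of d "- (2 ^ s)"] far[of s "d - d0"] far[of K "d - d0"] d 1(1) \<open>K \<le> s\<close>
        by (simp add: algebra_simps)
    qed
  next
    case 2
    show ?thesis
    proof (rule key[of "2 ^ K - d0"])
      fix d assume d: "\<bar>d\<bar> \<le> int r"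
      show "div_m s (i + d) \<longleftrightarrow> div_m K (2 ^ K - d0 + d)"
        using shift_div[OF 2(2), of d "2 ^ s"] far[of s "d - d0"] far[of K "d - d0"] d 2(1) \<open>K \<le> s\<close>
        by (simp add: algebra_simps)
      show "div_m s (i + d - 2 ^ s) \<longleftrightarrow> div_m K (2 ^ K - d0 + d - 2 ^ K)"
        using shift_div[OF 2(2), of d 0] near[of s "d - d0"] near[of K "d - d0"] d 2(1) \<open>K \<le> s\<close>
        by (simp add: algebra_simps)
    qed
  next
    case 3
    show ?thesis
    proof (cases "K = 0")
      case True
      then have "r = 0" using K by simp
      then have "w = []" using w by simp
      then show ?thesis by simp
    next
      case False
      \<comment> \<open>No mark is near \<open>i\<close>, so \<open>i'\<close> is the midpoint
        \<open>2 ^ k\<close> between the marks \<open>0\<close> and \<open>2 ^ K\<close>; its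
        distance to both exceeds \<open>r\<close>.\<close>
      then obtain k where k: "K = Suc k" by (cases K) auto
      have K2: "(2::int) ^ K = 2 * 2 ^ k" using k by simp
      have "\<not> div_m K (2 ^ k + d) \<and> \<not> div_m K (2 ^ k + d - 2 ^ K)" if "\<bar>d\<bar> \<le> int r" for d
      proof -
        have "2 ^ k + d \<noteq> 0" "2 ^ k + d - 2 ^ K \<noteq> 0"
          "\<bar>2 ^ k + d\<bar> < int (m K)" "\<bar>2 ^ k + d - 2 ^ K\<bar> < int (m K)"
          using that big[of K] K2 by linarith+
        then show ?thesis using div_m_small by blast
      qed
      then show ?thesis using 3 by (intro key[of "2 ^ k"]) auto
    qed
  qed
qed

section \<open>Translations of one layer and the commutators that yield them\<close>

definition bump :: "nat \<Rightarrow> (int \<Rightarrow> Enum.finite_3) \<Rightarrow> point \<Rightarrow> point" where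
  "bump s f = (\<lambda>(s', i, c). (s', i, if s' = s then c + f i else c))"

lemma bump_apply [simp]: "bump s f (s', i, c) = (s', i, if s' = s then c + f i else c)"
  by (simp add: bump_def)

lemma bump_comp: "bump s f \<circ> bump s g = bump s (\<lambda>i. f i + g i)"
  by (auto simp: fun_eq_iff)

definition spike :: "nat \<Rightarrow> int \<Rightarrow> Enum.finite_3 \<Rightarrow> int \<Rightarrow> Enum.finite_3" where
  "spike s j a = (\<lambda>i. if div_m s (i - j) then a else 0)"

text \<open>The conjugation carries the mark of \<open>flip1\<close> to \<open>0\<close> on layer
  \<open>s\<close>, where it meets the mark of \<open>flip0\<close>, and to
  \<open>2 ^ s' - 2 ^ s\<close> on any layer \<open>s'\<close>.\<close>

definition flip1_back :: "nat \<Rightarrow> point \<Rightarrow> point" where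
  "flip1_back s = shift (- (2 ^ s)) \<circ> flip1 \<circ> shift (2 ^ s)"

lemma flip1_back_apply:
  "flip1_back s (s', i, c) = (s', i, if div_m s' (i + 2 ^ s - 2 ^ s') then 1 - c else c)"
  by (simp add: flip1_back_def)

text \<open>A common mark forces \<open>2 ^ Suc s'\<close> to divide \<open>2 ^ s - 2 ^ s'\<close>.
  For \<open>s < s'\<close> this number is nonzero and too small; for \<open>s > s'\<close> the
  divisor also divides \<open>2 ^ s\<close>, hence would divide \<open>2 ^ s'\<close>.\<close>

lemma marks_separate:
  assumes "div_m s' i" "div_m s' (i + 2 ^ s - 2 ^ s')"
  shows "s' = s"
proof -
  have "(i + 2 ^ s - 2 ^ s') - i = 2 ^ s - 2 ^ s'" by simp
  then have "div_m s' (2 ^ s - 2 ^ s')" using assms by (metis dvd_diff)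
  moreover have "(2::int) ^ Suc s' dvd int (m s')"
    using pow_dvd_m[of s'] by (metis int_dvd_int_iff of_nat_numeral of_nat_power)
  ultimately have d: "(2::int) ^ Suc s' dvd 2 ^ s - 2 ^ s'" using dvd_trans by blast
  show ?thesis
  proof (cases s s' rule: linorder_cases)
    case less
    then have "(2::int) ^ s < 2 ^ s'" by simp
    moreover have "(0::int) < 2 ^ s" by simp
    moreover have "(2::int) * 2 ^ s' \<le> \<bar>2 ^ s - 2 ^ s'\<bar>" using dvd_imp_le_int[OF _ d] less by simp
    ultimately show ?thesis by linarith
  next
    case greater
    then have "(2::int) ^ Suc s' dvd 2 ^ s" by (intro le_imp_power_dvd) simp
    then have "(2::int) ^ Suc s' dvd 2 ^ s'" using d by (metis dvd_diff_right_iff)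
    then have "(2::int) ^ Suc s' \<le> 2 ^ s'" by (rule zdvd_imp_le) simp
    then show ?thesis by simp
  qed simp
qed

text \<open>Both factors are involutions, so this is their commutator. On layers other than
  \<open>s\<close> their supports are disjoint and they commute; at the common mark on layer
  \<open>s\<close> the product \<open>c - 1\<close> of the two reflections is squared, and
  \<open>c - 2 = c + 1\<close> in \<int>/3.\<close>

lemma commutator_spike:
  "flip0 \<circ> flip1_back s \<circ> flip0 \<circ> flip1_back s = bump s (spike s 0 1)"
proof
  fix p :: point
  obtain s' i c where p: "p = (s', i, c)" by (cases p) auto
  have "c - 1 - 1 = c + (1 :: Enum.finite_3)"
    using add_self_finite_3[of 1] by (simp add: diff_diff_eq)
  then show "(flip0 \<circ> flip1_back s \<circ> flip0 \<circ> flip1_back s) p = bump s (spike s 0 1) p"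
    using marks_separate[of s' i s] by (cases "s' = s") (auto simp: p flip1_back_apply spike_def)
qed

lemma flip0_perms: "flip0 \<in> perms" and flip1_perms: "flip1 \<in> perms"
  by (auto intro!: letters_perms simp: letters_def)

lemma flip1_back_perms: "flip1_back s \<in> perms"
  unfolding flip1_back_def by (intro comp_perms shift_perms flip1_perms)

lemma bump_shift: "shift (- j) \<circ> bump s f \<circ> shift j = bump s (\<lambda>i. f (i + j))"
  by (auto simp: fun_eq_iff)

text \<open>Height \<open>1\<close> at position \<open>0\<close> is the commutator, height
  \<open>- 1\<close> its square, and conjugation by a shift moves the spike to
  \<open>j\<close>.\<close>

lemma bump_spike_perms: "bump s (spike s j a) \<in> perms"
proof -
  have one: "bump s (spike s 0 1) \<in> perms"
    by (metis commutator_spike comp_perms flip0_perms flip1_back_perms)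
  have "bump s (spike s 0 (- 1)) = bump s (spike s 0 1) \<circ> bump s (spike s 0 1)"
    using add_self_finite_3[of 1] by (auto simp: bump_comp spike_def fun_eq_iff)
  then have minus: "bump s (spike s 0 (- 1)) \<in> perms" using one comp_perms by metis
  have "bump s (spike s 0 0) = id" by (auto simp: spike_def fun_eq_iff)
  then have zero: "bump s (spike s 0 0) \<in> perms" using id_perms by metis
  have "bump s (spike s 0 a) \<in> perms"
    using nonzero_finite_3[of a] one minus zero by (cases "a = 0") auto
  moreover have "bump s (spike s j a) = shift (- (- j)) \<circ> bump s (spike s 0 a) \<circ> shift (- j)"
    unfolding bump_shift by (simp add: spike_def)
  ultimately show ?thesis using comp_perms shift_perms by metis
qed

text \<open>This is the subgroup (\<int>/3) ^ \<open>m s\<close> attached to layer \<open>s\<close>.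
  Extensional functions on one period make the parametrisation injective, so that its elements can
  be counted.\<close>

definition periodic_bumps :: "nat \<Rightarrow> (point \<Rightarrow> point) set" where
  "periodic_bumps s = (\<lambda>\<phi>. bump s (\<lambda>i. \<phi> (i mod int (m s)))) ` ({0..<int (m s)} \<rightarrow>\<^sub>E UNIV)"

lemma periodic_bumps_perms: "periodic_bumps s \<subseteq> perms"
proof -
  \<comment> \<open>Residues are filled in one at a time: passing from \<open>n\<close> to
    \<open>Suc n\<close> composes with a single spike at \<open>n\<close>.\<close>
  have "bump s (\<lambda>i. if i mod int (m s) < int n then \<phi> (i mod int (m s)) else 0) \<in> perms"
    if "n \<le> m s" for n \<phi>
    using that
  proof (induction n)
    case 0
    have "\<not> i mod int (m s) < 0" for i using m_pos[of s] by (simp add: not_less)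
    then have "bump s (\<lambda>i. if i mod int (m s) < int 0 then \<phi> (i mod int (m s)) else 0) = id"
      by (auto simp: fun_eq_iff)
    then show ?case using id_perms by metis
  next
    case (Suc n)
    have "div_m s (i - int n) \<longleftrightarrow> i mod int (m s) = int n" for i
      using Suc.prems by (simp add: mod_eq_dvd_iff[symmetric])
    then have "bump s (\<lambda>i. if i mod int (m s) < int (Suc n) then \<phi> (i mod int (m s)) else 0) =
      bump s (\<lambda>i. if i mod int (m s) < int n then \<phi> (i mod int (m s)) else 0) \<circ>
      bump s (spike s (int n) (\<phi> (int n)))"
      unfolding bump_comp by (intro arg_cong[of _ _ "bump s"]) (auto simp: spike_def fun_eq_iff)
    also have "\<dots> \<in> perms"
      by (intro comp_perms Suc.IH bump_spike_perms) (use Suc.prems in simp)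
    finally show ?case .
  qed
  from this[of "m s"] m_pos[of s] show ?thesis
    by (auto simp: periodic_bumps_def)
qed

lemma card_periodic_bumps: "card (periodic_bumps s) = 3 ^ m s"
proof -
  have "inj_on (\<lambda>\<phi>. bump s (\<lambda>i. \<phi> (i mod int (m s)))) ({0..<int (m s)} \<rightarrow>\<^sub>E UNIV)"
  proof (rule inj_onI)
    fix \<phi> \<psi> assume PiE: "\<phi> \<in> {0..<int (m s)} \<rightarrow>\<^sub>E UNIV" "\<psi> \<in> {0..<int (m s)} \<rightarrow>\<^sub>E UNIV"
      and eq: "bump s (\<lambda>i. \<phi> (i mod int (m s))) = bump s (\<lambda>i. \<psi> (i mod int (m s)))"
    show "\<phi> = \<psi>"
    proof (rule PiE_ext[OF PiE])
      fix i assume "i \<in> {0..<int (m s)}"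
      then show "\<phi> i = \<psi> i" using fun_cong[OF eq, of "(s, i, 0)"] by simp
    qed
  qed
  then have "card (periodic_bumps s) = card ({0..<int (m s)} \<rightarrow>\<^sub>E (UNIV :: Enum.finite_3 set))"
    unfolding periodic_bumps_def by (rule card_image)
  also have "\<dots> = 3 ^ m s" by (simp add: card_funcsetE UNIV_finite_3 numeral_3_eq_3)
  finally show ?thesis .
qed

lemma periodic_bumpsI:
  assumes "\<And>i. F (i mod int (m s)) = F i"
  shows "bump s F \<in> periodic_bumps s"
proof -
  have "bump s F = bump s (\<lambda>i. restrict F {0..<int (m s)} (i mod int (m s)))"
    using assms m_pos[of s] by (intro arg_cong[of _ _ "bump s"]) (auto simp: fun_eq_iff)
  then show ?thesis unfolding periodic_bumps_def
    by (intro image_eqI[of _ _ "restrict F {0..<int (m s)}"]) auto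
qed

lemma periodic_bumps_quotient:
  assumes "f \<in> periodic_bumps s" "g \<in> periodic_bumps s"
  obtains h where "h \<in> periodic_bumps s" "f \<circ> h = g"
proof -
  from assms obtain \<phi> \<psi> where f: "f = bump s (\<lambda>i. \<phi> (i mod int (m s)))"
    and g: "g = bump s (\<lambda>i. \<psi> (i mod int (m s)))" by (auto simp: periodic_bumps_def)
  let ?h = "bump s (\<lambda>i. \<psi> (i mod int (m s)) - \<phi> (i mod int (m s)))"
  have "?h \<in> periodic_bumps s" by (rule periodic_bumpsI) simp
  moreover have "f \<circ> ?h = g" by (simp add: f g bump_comp)
  ultimately show thesis using that by blast
qed

text \<open>
  The commutator of a bump with \<open>flip0\<close> is supported at position \<open>0\<close>: there \<open>flip0\<close> inverts
  the translation, everywhere else the two commute.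
\<close>

lemma bump_normal_closure:
  assumes "N \<subseteq> perms"
    and comp: "\<And>f g. f \<in> N \<Longrightarrow> g \<in> N \<Longrightarrow> f \<circ> g \<in> N"
    and conj: "\<And>f g h. f \<in> N \<Longrightarrow> g \<in> perms \<Longrightarrow> h \<in> perms \<Longrightarrow> g \<circ> h = id \<Longrightarrow> g \<circ> f \<circ> h \<in> N"
    and inverse: "\<And>f g. f \<in> N \<Longrightarrow> f \<circ> g = id \<Longrightarrow> g \<in> N"
    and f: "f \<in> periodic_bumps s" "f \<in> N" "f \<noteq> id"
  shows "bump s (spike s 0 1) \<in> N"
proof -
  obtain \<phi> where \<phi>: "f = bump s (\<lambda>i. \<phi> (i mod int (m s)))"
    using f(1) by (auto simp: periodic_bumps_def)
  \<comment> \<open>Conjugating by a shift brings a nonzero value to position \<open>0\<close>,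
    where \<open>flip0\<close> acts.\<close>
  then obtain j where j: "\<phi> (j mod int (m s)) \<noteq> 0"
    using f(3) by (auto simp: fun_eq_iff split: if_splits)
  define F where "F = (\<lambda>i. \<phi> ((i + j) mod int (m s)))"
  have per: "F i = F 0" if "div_m s i" for i
    using that by (auto simp: F_def mod_eq_dvd_iff intro!: arg_cong[of _ _ \<phi>])
  have F: "bump s F \<in> N"
    using conj[OF f(2) shift_perms[of "- j"] shift_perms[of j]]
    by (simp add: \<phi> bump_shift F_def shift_comp shift_zero)
  have "bump s (\<lambda>i. - F i) \<in> N" 
    by (rule inverse[OF F]) (auto simp: fun_eq_iff)
  then have "flip0 \<circ> bump s (\<lambda>i. - F i) \<circ> flip0 \<in> N"
    by (rule conj[OF _ flip0_perms flip0_perms flip0_flip0])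
  then have "bump s F \<circ> (flip0 \<circ> bump s (\<lambda>i. - F i) \<circ> flip0) \<in> N" by (rule comp[OF F])
  also have "bump s F \<circ> (flip0 \<circ> bump s (\<lambda>i. - F i) \<circ> flip0) = bump s (spike s 0 (F 0 + F 0))"
  proof
    fix p :: point
    obtain s' i c where "p = (s', i, c)" by (cases p) auto
    then show "(bump s F \<circ> (flip0 \<circ> bump s (\<lambda>i. - F i) \<circ> flip0)) p = bump s (spike s 0 (F 0 + F 0)) p"
      using per[of i] by (cases "s' = s"; cases "div_m s i") (simp_all add: spike_def)
  qed
  finally have N: "bump s (spike s 0 (- F 0)) \<in> N" unfolding add_self_finite_3 .
  \<comment> \<open>The spike has height \<open>F 0 + F 0 = - F 0\<close>, which is \<open>1\<close>
    or \<open>- 1\<close>; in the latter case its square has height \<open>1\<close>.\<close>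
  have "- F 0 = 1 \<or> - F 0 = - 1" using j nonzero_finite_3[of "- F 0"] unfolding F_def by (metis add_0 neg_equal_0_iff_equal)
  then show ?thesis
  proof
    assume "- F 0 = - 1"
    moreover have "bump s (spike s 0 (- 1)) \<circ> bump s (spike s 0 (- 1)) = bump s (spike s 0 1)"
      using add_self_finite_3[of "- 1"] by (auto simp: bump_comp spike_def fun_eq_iff)
    ultimately show ?thesis using comp N by metis
  qed (use N in simp)
qed

end

section \<open>The groups\<close>

text \<open>The group must live on natural numbers, so composition is transported along an
  enumeration of the countable set \<open>H\<close>.\<close>

lemma countable_function_group:
  assumes "countable H" and id: "id \<in> H"
    and comp: "\<And>f g. f \<in> H \<Longrightarrow> g \<in> H \<Longrightarrow> f \<circ> g \<in> H"
    and inverse: "\<And>f. f \<in> H \<Longrightarrow> \<exists>g\<in>H. g \<circ> f = id"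
  obtains G :: "nat monoid" and \<rho> where "group G" "bij_betw \<rho> (carrier G) H"
    "\<And>a b. a \<in> carrier G \<Longrightarrow> b \<in> carrier G \<Longrightarrow> \<rho> (a \<otimes>\<^bsub>G\<^esub> b) = \<rho> a \<circ> \<rho> b"
proof -
  define code where "code = to_nat_on H"
  define \<rho> where "\<rho> = from_nat_into H"
  have \<rho>_code: "\<rho> (code f) = f" if "f \<in> H" for f
    using that \<open>countable H\<close> by (simp add: code_def \<rho>_def)
  define G where "G = \<lparr>carrier = code ` H, monoid.mult = (\<lambda>a b. code (\<rho> a \<circ> \<rho> b)), one = code id\<rparr>"
  have "group G"
  proof (rule groupI)
    fix a assume "a \<in> carrier G"
    then obtain f where f: "f \<in> H" "a = code f" by (auto simp: G_def)
    then obtain g where "g \<in> H" "g \<circ> f = id" using inverse by blast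
    then show "\<exists>b\<in>carrier G. b \<otimes>\<^bsub>G\<^esub> a = \<one>\<^bsub>G\<^esub>"
      using f by (intro bexI[of _ "code g"]) (auto simp: G_def \<rho>_code)
  qed (auto simp: G_def \<rho>_code id comp comp_assoc)
  moreover have "bij_betw \<rho> (carrier G) H"
    by (rule bij_betw_byWitness[of _ code]) (auto simp: G_def \<rho>_code)
  moreover have "\<rho> (a \<otimes>\<^bsub>G\<^esub> b) = \<rho> a \<circ> \<rho> b" if "a \<in> carrier G" "b \<in> carrier G" for a b
    using that by (auto simp: G_def \<rho>_code comp)
  ultimately show thesis using that by blast
qed

context group
begin

lemma lcos_eq_iff:
  assumes "subgroup N G" "a \<in> carrier G" "b \<in> carrier G"
  shows "a <# N = b <# N \<longleftrightarrow> inv a \<otimes> b \<in> N"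
proof
  assume "a <# N = b <# N"
  then have "b \<in> a <# N" using lcos_self[OF assms(3,1)] by simp
  then show "inv a \<otimes> b \<in> N" using subgroup.lcos_module_imp[OF assms(1) is_group assms(2)] by simp
next
  assume "inv a \<otimes> b \<in> N"
  then have "b \<in> a <# N" using subgroup.lcos_module_rev[OF assms(1) is_group assms(2,3)] by simp
  then show "a <# N = b <# N" using l_repr_independence assms by metis
qed

text \<open>Elements with equal \<open>\<Phi>\<close> lie in one coset, so choosing a representative
  for each value covers all cosets by an image of \<open>T\<close>.\<close>

lemma card_lcosets_le:
  assumes N: "subgroup N G" and T: "finite T" "\<And>a. a \<in> carrier G \<Longrightarrow> \<Phi> a \<in> T"
    and \<Phi>: "\<And>a b. a \<in> carrier G \<Longrightarrow> b \<in> carrier G \<Longrightarrow> \<Phi> a = \<Phi> b \<Longrightarrow> inv a \<otimes> b \<in> N"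
  shows "finite (lcosets N) \<and> card (lcosets N) \<le> card T"
proof -
  define c where "c t = (SOME a. a \<in> carrier G \<and> \<Phi> a = t) <# N" for t
  have "c (\<Phi> a) = a <# N" if "a \<in> carrier G" for a
    unfolding c_def by (rule someI2[of _ a]) (use that lcos_eq_iff[OF N] \<Phi> in auto)
  then have sub: "lcosets N \<subseteq> c ` T" using T(2) by (fastforce simp: LCOSETS_def)
  then show ?thesis
    using T(1) by (meson card_image_le card_mono finite_imageI finite_subset le_trans)
qed

end

section \<open>The group and its word balls in terms of permutations\<close>

locale layered_group = layered_action m + group G
  for m and G :: "'a monoid" (structure) +
  fixes \<rho> :: "'a \<Rightarrow> point \<Rightarrow> point"
  assumes bij_rho: "bij_betw \<rho> (carrier G) perms"
    and rho_mult: "a \<in> carrier G \<Longrightarrow> b \<in> carrier G \<Longrightarrow> \<rho> (a \<otimes> b) = \<rho> a \<circ> \<rho> b"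
begin

lemma rho_perms: "a \<in> carrier G \<Longrightarrow> \<rho> a \<in> perms"
  using bij_rho by (auto simp: bij_betw_def)

lemma rho_eq_iff: "a \<in> carrier G \<Longrightarrow> b \<in> carrier G \<Longrightarrow> \<rho> a = \<rho> b \<longleftrightarrow> a = b"
  using bij_rho by (auto simp: bij_betw_def inj_on_def)

definition elt :: "(point \<Rightarrow> point) \<Rightarrow> 'a" where
  "elt = inv_into (carrier G) \<rho>"

lemma elt_closed: "f \<in> perms \<Longrightarrow> elt f \<in> carrier G"
  using bij_rho unfolding elt_def bij_betw_def by (metis inv_into_into)

lemma rho_elt: "f \<in> perms \<Longrightarrow> \<rho> (elt f) = f"
  using bij_rho unfolding elt_def bij_betw_def by (metis f_inv_into_f)

lemma elt_rho: "a \<in> carrier G \<Longrightarrow> elt (\<rho> a) = a"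
  using rho_eq_iff rho_perms elt_closed rho_elt by metis

lemma rho_one: "\<rho> \<one> = id"
proof -
  have "\<rho> (\<one> \<otimes> elt id) = \<rho> \<one> \<circ> id"
    using rho_mult[OF one_closed elt_closed[OF id_perms]] by (simp add: rho_elt[OF id_perms])
  then show ?thesis using elt_closed[OF id_perms] rho_elt[OF id_perms] by simp
qed

lemma rho_inv: "a \<in> carrier G \<Longrightarrow> \<rho> (inv a) \<circ> \<rho> a = id"
  using rho_mult[of "inv a" a] by (simp add: rho_one)

lemma rho_inv_right: "a \<in> carrier G \<Longrightarrow> \<rho> a \<circ> \<rho> (inv a) = id"
  using rho_mult[of a "inv a"] by (simp add: rho_one)

lemma rho_inv_unique:
  assumes "a \<in> carrier G" "\<rho> a \<circ> g = id"
  shows "\<rho> (inv a) = g"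
proof -
  have "g = \<rho> (inv a) \<circ> \<rho> a \<circ> g" using rho_inv[OF assms(1)] by simp
  also have "\<dots> = \<rho> (inv a)" using assms(2) by (simp only: comp_assoc comp_id)
  finally show ?thesis by simp
qed

lemma rho_inv_unique_left:
  assumes "a \<in> carrier G" "g \<circ> \<rho> a = id"
  shows "\<rho> (inv a) = g"
proof -
  have "g = g \<circ> (\<rho> a \<circ> \<rho> (inv a))" using rho_inv_right[OF assms(1)] by simp
  also have "\<dots> = \<rho> (inv a)" using assms(2) by (simp only: o_assoc id_comp)
  finally show ?thesis by simp
qed

lemma inv_elt:
  assumes "f \<in> perms" "g \<in> perms" "f \<circ> g = id"
  shows "inv (elt f) = elt g"
proof -
  have "\<rho> (inv (elt f)) = g"
    by (rule rho_inv_unique) (use assms in \<open>simp_all only: elt_closed rho_elt\<close>)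
  then show ?thesis using elt_rho[of "inv (elt f)"] elt_closed[OF assms(1)] by simp
qed

definition gens :: "'a set" where
  "gens = elt ` {shift 1, flip0, flip1}"

lemma gens_inv: "gens \<union> m_inv G ` gens = elt ` letters"
proof -
  have "inv (elt (shift 1)) = elt (shift (- 1))"
    by (rule inv_elt) (auto simp: shift_perms shift_comp shift_zero)
  moreover have "inv (elt flip0) = elt flip0" "inv (elt flip1) = elt flip1"
    using inv_elt flip0_perms flip1_perms flip0_flip0 flip1_flip1 by blast+
  ultimately show ?thesis by (auto simp: gens_def letters_def)
qed

lemma rho_word:
  "set w \<subseteq> letters \<Longrightarrow> foldr (\<otimes>) (map elt w) \<one> \<in> carrier G \<and>
     \<rho> (foldr (\<otimes>) (map elt w) \<one>) = eval w"
  by (induction w) (use letters_perms in \<open>auto simp: rho_one rho_mult elt_closed rho_elt\<close>)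

lemma word_ball_iff:
  "a \<in> word_ball G gens n \<longleftrightarrow>
     a \<in> carrier G \<and> (\<exists>w. set w \<subseteq> letters \<and> length w \<le> n \<and> \<rho> a = eval w)"
proof
  assume "a \<in> word_ball G gens n"
  then obtain u where u: "length u \<le> n" "set u \<subseteq> elt ` letters" "a = foldr (\<otimes>) u \<one>"
    unfolding word_ball_def gens_inv by blast
  have "map elt (map \<rho> u) = u" "set (map \<rho> u) \<subseteq> letters"
    using u(2) rho_elt letters_perms by (auto intro!: map_idI)
  then show "a \<in> carrier G \<and> (\<exists>w. set w \<subseteq> letters \<and> length w \<le> n \<and> \<rho> a = eval w)"
    using rho_word[of "map \<rho> u"] u by (metis length_map)
next
  assume "a \<in> carrier G \<and> (\<exists>w. set w \<subseteq> letters \<and> length w \<le> n \<and> \<rho> a = eval w)"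
  then obtain w where w: "a \<in> carrier G" "set w \<subseteq> letters" "length w \<le> n" "\<rho> a = eval w" by blast
  then have "a = foldr (\<otimes>) (map elt w) \<one>" using rho_word[OF w(2)] rho_eq_iff by metis
  then show "a \<in> word_ball G gens n"
    using w unfolding word_ball_def gens_inv by (intro CollectI exI[of _ "map elt w"]) auto
qed

lemma word_ball_mono: "k \<le> n \<Longrightarrow> word_ball G gens k \<subseteq> word_ball G gens n"
  unfolding word_ball_def by auto

lemma in_some_word_ball:
  assumes "a \<in> carrier G"
  obtains n where "a \<in> word_ball G gens n"
  using rho_perms[OF assms] assms word_ball_iff by (metis order_refl perms_cases)

lemma gens_carrier: "gens \<subseteq> carrier G"
  unfolding gens_def using elt_closed flip0_perms flip1_perms shift_perms by blast

lemma generate_gens: "generate G gens = carrier G"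
proof
  show "generate G gens \<subseteq> carrier G" by (rule generate_incl[OF gens_carrier])
  show "carrier G \<subseteq> generate G gens"
  proof
    fix a assume "a \<in> carrier G"
    then obtain n where "a \<in> word_ball G gens n" by (rule in_some_word_ball)
    then obtain u where u: "set u \<subseteq> gens \<union> m_inv G ` gens" "a = foldr (\<otimes>) u \<one>"
      unfolding word_ball_def by blast
    have "set u \<subseteq> gens \<union> m_inv G ` gens \<Longrightarrow> foldr (\<otimes>) u \<one> \<in> generate G gens"
      by (induction u) (auto intro: generate.intros)
    then show "a \<in> generate G gens" using u by simp
  qed
qed

section \<open>Lower bound: the index of a normal subgroup that is injective on a ball\<close>

text \<open>Injectivity on the ball keeps the commutator of layer \<open>s\<close> out of
  \<open>N\<close>. By \<open>bump_normal_closure\<close>, \<open>N\<close> then contains no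
  nontrivial periodic bump, so the \<open>3 ^ m s\<close> bumps lie in distinct cosets.\<close>

lemma card_lcosets_ge:
  assumes "N \<lhd> G" and fin: "finite (lcosets N)"
    and inj: "inj_on (\<lambda>a. a <# N) (word_ball G gens n)" and n: "2 * 2 ^ s + 2 \<le> n"
  shows "3 ^ m s \<le> card (lcosets N)"
proof -
  interpret N: normal N G by fact
  have sub: "subgroup N G" by (rule N.subgroup_axioms)
  \<comment> \<open>The commutator is \<open>A \<circ> A\<close>, and \<open>B\<close> is the
    inverse of \<open>A\<close>; so it lies in \<open>N\<close> exactly when \<open>A\<close> and
    \<open>B\<close> share a coset. Only words for half of the commutator are needed.\<close>
  define A where "A = flip0 \<circ> flip1_back s"
  define B where "B = flip1_back s \<circ> flip0"
  have AB: "A \<in> perms" "B \<in> perms"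
    unfolding A_def B_def by (intro comp_perms flip0_perms flip1_back_perms)+
  have back_back: "flip1_back s \<circ> flip1_back s = id"
    by (auto simp: fun_eq_iff flip1_back_apply)
  have "B \<circ> A = flip1_back s \<circ> (flip0 \<circ> flip0) \<circ> flip1_back s"
    by (simp add: A_def B_def comp_assoc)
  then have "B \<circ> A = id" by (simp add: flip0_flip0 back_back)
  then have inv_B: "inv (elt B) = elt A" by (rule inv_elt[OF AB(2,1)])
  have eval_rep: "eval (replicate k (shift d)) = shift (int k * d)" for k d
    by (induction k) (auto simp: shift_zero shift_comp algebra_simps)
  \<comment> \<open>Shifting \<open>2 ^ s\<close> steps, flipping and shifting back takes
    \<open>2 * 2 ^ s + 1\<close> letters; one more for \<open>flip0\<close> gives the bound on
    \<open>n\<close>.\<close>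
  define v where "v = replicate (2 ^ s) (shift (- 1)) @ flip1 # replicate (2 ^ s) (shift 1)"
  have v: "set v \<subseteq> letters" "length v = 2 * 2 ^ s + 1" "eval v = flip1_back s"
    by (auto simp: v_def letters_def eval_append eval_rep flip1_back_def comp_assoc)
  have flip0: "flip0 \<in> letters" by (simp add: letters_def)
  have "elt A \<in> word_ball G gens n"
    unfolding word_ball_iff using AB v n flip0
    by (auto simp: elt_closed rho_elt A_def intro!: exI[of _ "flip0 # v"])
  moreover have "elt B \<in> word_ball G gens n"
    unfolding word_ball_iff using AB v n flip0
    by (auto simp: elt_closed rho_elt B_def eval_append intro!: exI[of _ "v @ [flip0]"])
  moreover define w where "w = bump s (spike s 0 1)"
  have rho_w: "\<rho> (inv (elt B) \<otimes> elt A) = w"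
    using AB commutator_spike[of s] by (simp add: inv_B rho_mult elt_closed rho_elt A_def comp_assoc w_def)
  have "w (s, 0, 0) \<noteq> id (s, 0, 0)" by (simp add: w_def spike_def)
  then have "w \<noteq> id" by metis
  then have "elt A \<noteq> elt B" using rho_w AB elt_closed rho_one by (metis l_inv)
  ultimately have "elt B <# N \<noteq> elt A <# N" using inj by (metis inj_onD)
  then have "inv (elt B) \<otimes> elt A \<notin> N" using lcos_eq_iff[OF sub] AB elt_closed by blast
  then have w_notin: "w \<notin> \<rho> ` N"
    using rho_w rho_eq_iff[of "inv (elt B) \<otimes> elt A"] AB elt_closed N.mem_carrier
    by (metis (no_types, opaque_lifting) imageE inv_closed m_closed)
  have trivial: "f = id" if "f \<in> periodic_bumps s" "f \<in> \<rho> ` N" for f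
  proof (rule ccontr)
    assume "f \<noteq> id"
    have "w \<in> \<rho> ` N"
      unfolding w_def
    proof (rule bump_normal_closure[OF _ _ _ _ that \<open>f \<noteq> id\<close>])
      show "\<rho> ` N \<subseteq> perms" using rho_perms N.subset by blast
      show "g \<circ> h \<in> \<rho> ` N" if gh: "g \<in> \<rho> ` N" "h \<in> \<rho> ` N" for g h
      proof -
        obtain a b where ab: "a \<in> N" "b \<in> N" "g = \<rho> a" "h = \<rho> b" using gh by blast
        then have "g \<circ> h = \<rho> (a \<otimes> b)" by (simp only: rho_mult N.mem_carrier)
        then show ?thesis using ab N.m_closed by blast
      qed
      show "g \<circ> f \<circ> h \<in> \<rho> ` N" if f: "f \<in> \<rho> ` N" and g: "g \<in> perms" "h \<in> perms" "g \<circ> h = id" for f g h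
      proof -
        obtain a where a: "a \<in> N" "f = \<rho> a" using f by blast
        have "elt g \<otimes> a \<otimes> inv (elt g) \<in> N" by (rule N.inv_op_closed2[OF elt_closed[OF g(1)] a(1)])
        moreover have "\<rho> (elt g \<otimes> a \<otimes> inv (elt g)) = g \<circ> f \<circ> h"
          using a(2) g by (simp only: inv_elt rho_mult rho_elt elt_closed N.mem_carrier[OF a(1)] m_closed)
        ultimately show ?thesis by (intro image_eqI) (rule sym)
      qed
      show "g \<in> \<rho> ` N" if f: "f \<in> \<rho> ` N" "f \<circ> g = id" for f g
      proof -
        obtain a where a: "a \<in> N" "f = \<rho> a" using f by blast
        have "\<rho> (inv a) = g" using rho_inv_unique[of a g] f(2) a(2) N.mem_carrier[OF a(1)] by simp
        then show ?thesis using N.m_inv_closed[OF a(1)] by (metis imageI)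
      qed
    qed
    then show False using w_notin by contradiction
  qed
  \<comment> \<open>Two bumps in one coset differ by a periodic bump coming from \<open>N\<close>,
    which is trivial.\<close>
  have "inj_on (\<lambda>f. elt f <# N) (periodic_bumps s)"
  proof (rule inj_onI)
    fix f g assume fg: "f \<in> periodic_bumps s" "g \<in> periodic_bumps s" and eq: "elt f <# N = elt g <# N"
    have perms: "f \<in> perms" "g \<in> perms" using fg periodic_bumps_perms by blast+
    obtain h where h: "h \<in> periodic_bumps s" "f \<circ> h = g" using fg by (rule periodic_bumps_quotient)
    have "\<rho> (inv (elt f) \<otimes> elt g) = \<rho> (inv (elt f)) \<circ> \<rho> (elt f) \<circ> h"
      using perms h by (simp add: rho_mult rho_elt elt_closed comp_assoc)
    also have "\<dots> = h" using rho_inv[OF elt_closed[OF perms(1)]] by simp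
    finally have "\<rho> (inv (elt f) \<otimes> elt g) = h" .
    moreover have "inv (elt f) \<otimes> elt g \<in> N"
      using lcos_eq_iff[OF sub] eq elt_closed perms by blast
    ultimately have "h = id" using trivial[OF h(1)] by blast
    then show "f = g" using h(2) by simp
  qed
  moreover have "(\<lambda>f. elt f <# N) ` periodic_bumps s \<subseteq> lcosets N"
    using elt_closed periodic_bumps_perms by (auto simp: LCOSETS_def)
  ultimately have "card (periodic_bumps s) \<le> card (lcosets N)" using fin by (rule card_inj_on_le)
  then show ?thesis by (simp add: card_periodic_bumps)
qed

section \<open>Upper bound: the action on finitely many layers\<close>

text \<open>This is the kernel of the action on the layers up to \<open>K\<close> with positions
  read modulo \<open>m s\<close>. Since positions are integers here, a shift by a common multiple
  \<open>T\<close> of the periods has to count as trivial; without this the index would be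
  infinite.\<close>

definition layer_kernel :: "nat \<Rightarrow> 'a set" where
  "layer_kernel K = {a \<in> carrier G. \<exists>T. \<forall>s\<le>K. div_m s T \<and> (\<forall>i c. \<rho> a (s, i, c) = (s, i + T, c))}"

lemma perms_shift_commute:
  assumes "f \<in> perms" "div_m s T"
  shows "f (s, i + T, c) = shift T (f (s, i, c))"
proof -
  from assms(1) obtain \<tau> h where "\<And>s i c. f (s, i, c) = (s, i + \<tau>, h s i c)"
    and "\<And>s i c T. div_m s T \<Longrightarrow> h s (i + T) c = h s i c" by (rule perms_form) blast
  then show ?thesis using assms(2) by simp
qed

lemma perms_layer:
  assumes "f \<in> perms"
  obtains j d where "f (s, i, c) = (s, j, d)"
proof -
  from assms obtain \<tau> h where "\<And>s i c. f (s, i, c) = (s, i + \<tau>, h s i c)" by (rule perms_form) blast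
  then show thesis by (rule that)
qed

lemma layer_kernelI:
  assumes "a \<in> carrier G" "\<And>s. s \<le> K \<Longrightarrow> div_m s T"
    and "\<And>s i c. s \<le> K \<Longrightarrow> \<rho> a (s, i, c) = (s, i + T, c)"
  shows "a \<in> layer_kernel K"
  unfolding layer_kernel_def using assms by (intro CollectI conjI exI[of _ T]) simp_all

lemma layer_kernelE:
  assumes "a \<in> layer_kernel K"
  obtains T where "a \<in> carrier G" "\<And>s. s \<le> K \<Longrightarrow> div_m s T"
    "\<And>s i c. s \<le> K \<Longrightarrow> \<rho> a (s, i, c) = (s, i + T, c)"
proof -
  from assms obtain T where "a \<in> carrier G"
    "\<forall>s\<le>K. div_m s T \<and> (\<forall>i c. \<rho> a (s, i, c) = (s, i + T, c))"
    unfolding layer_kernel_def mem_Collect_eq by (elim conjE exE)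
  then show thesis by (intro that[of T]) simp_all
qed

lemma layer_kernel_subgroup: "subgroup (layer_kernel K) G"
proof (rule subgroupI)
  have "\<one> \<in> layer_kernel K" by (rule layer_kernelI[of _ _ 0]) (simp_all add: rho_one)
  then show "layer_kernel K \<noteq> {}" by blast
next
  fix a assume "a \<in> layer_kernel K"
  then obtain T where a: "a \<in> carrier G" and T: "\<And>s. s \<le> K \<Longrightarrow> div_m s T"
    "\<And>s i c. s \<le> K \<Longrightarrow> \<rho> a (s, i, c) = (s, i + T, c)"
    by (rule layer_kernelE) blast
  have "\<rho> (inv a) (s, i, c) = (s, i + - T, c)" if "s \<le> K" for s i c
  proof -
    have "\<rho> (inv a) (\<rho> a (s, i - T, c)) = (s, i - T, c)"
      using fun_cong[OF rho_inv[OF a], of "(s, i - T, c)"] by simp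
    then show ?thesis using T(2)[OF that, of "i - T" c] by simp
  qed
  then show "inv a \<in> layer_kernel K" using a T(1) by (intro layer_kernelI[of _ _ "- T"]) simp_all
next
  fix a b assume "a \<in> layer_kernel K"
  then obtain T where a: "a \<in> carrier G" and T: "\<And>s. s \<le> K \<Longrightarrow> div_m s T"
    "\<And>s i c. s \<le> K \<Longrightarrow> \<rho> a (s, i, c) = (s, i + T, c)"
    by (rule layer_kernelE) blast
  assume "b \<in> layer_kernel K"
  then obtain U where b: "b \<in> carrier G" and U: "\<And>s. s \<le> K \<Longrightarrow> div_m s U"
    "\<And>s i c. s \<le> K \<Longrightarrow> \<rho> b (s, i, c) = (s, i + U, c)"
    by (rule layer_kernelE) blast
  show "a \<otimes> b \<in> layer_kernel K"
    by (rule layer_kernelI[of _ _ "U + T"]) (use a b T U in \<open>simp_all add: rho_mult\<close>)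
qed (auto elim: layer_kernelE)

text \<open>On the layers up to \<open>K\<close>, a shift by a common multiple of the periods
  commutes with every group element, so conjugation preserves it with the same
  \<open>T\<close>.\<close>

lemma layer_kernel_normal: "layer_kernel K \<lhd> G"
  unfolding normal_inv_iff
proof (intro conjI ballI)
  fix a b assume a: "a \<in> carrier G" and "b \<in> layer_kernel K"
  then obtain T where b: "b \<in> carrier G" and T: "\<And>s. s \<le> K \<Longrightarrow> div_m s T"
    "\<And>s i c. s \<le> K \<Longrightarrow> \<rho> b (s, i, c) = (s, i + T, c)"
    by (elim layer_kernelE) blast
  have "\<rho> (a \<otimes> b \<otimes> inv a) (s, i, c) = (s, i + T, c)" if "s \<le> K" for s i c
  proof -
    obtain j d where jd: "\<rho> (inv a) (s, i, c) = (s, j, d)"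
      using rho_perms[OF inv_closed[OF a]] by (rule perms_layer)
    have "\<rho> (a \<otimes> b \<otimes> inv a) (s, i, c) = \<rho> a (s, j + T, d)"
      using a b jd T(2)[OF that] by (simp add: rho_mult)
    also have "\<dots> = shift T (\<rho> a (s, j, d))"
      using perms_shift_commute[OF rho_perms[OF a]] T(1)[OF that] by simp
    also have "\<rho> a (s, j, d) = (s, i, c)"
      using fun_cong[OF rho_inv_right[OF a], of "(s, i, c)"] jd by simp
    finally show ?thesis by simp
  qed
  then show "a \<otimes> b \<otimes> inv a \<in> layer_kernel K"
    using a b T(1) by (intro layer_kernelI[of _ _ T]) simp_all
qed (rule layer_kernel_subgroup)

text \<open>A coset is determined by the displacement modulo each \<open>m s\<close> and by the
  \<int>/3-coordinates of the images of one period of each layer. Layer \<open>s\<close> allows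
  \<open>m s\<close> displacements and at most \<open>3 ^ (3 * m s)\<close> functions on its
  \<open>3 * m s\<close> points.\<close>

lemma index_layer_kernel:
  "finite (lcosets (layer_kernel K)) \<and>
   card (lcosets (layer_kernel K)) \<le> (\<Prod>s\<le>K. m s * 3 ^ (3 * m s))"
proof -
  define \<Omega> where "\<Omega> = (SIGMA s:{..K}. {0..<int (m s)} \<times> (UNIV :: Enum.finite_3 set))"
  define T where "T = (PiE {..K} (\<lambda>s. {0..<int (m s)})) \<times> (\<Omega> \<rightarrow>\<^sub>E (UNIV :: Enum.finite_3 set))"
  define \<Phi> where "\<Phi> a = (restrict (\<lambda>s. fst (snd (\<rho> a (s, 0, 0))) mod int (m s)) {..K},
    restrict (\<lambda>p. snd (snd (\<rho> a p))) \<Omega>)" for a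
  have "finite \<Omega>" by (auto simp: \<Omega>_def)
  then have "finite T" by (auto simp: T_def intro!: finite_PiE)
  have three: "card (UNIV :: Enum.finite_3 set) = 3" by (simp add: UNIV_finite_3 numeral_3_eq_3)
  have "card \<Omega> = (\<Sum>s\<le>K. 3 * m s)" by (simp add: \<Omega>_def card_cartesian_product three mult.commute)
  then have "card T = (\<Prod>s\<le>K. m s) * 3 ^ (\<Sum>s\<le>K. 3 * m s)"
    using \<open>finite \<Omega>\<close> by (simp add: T_def card_cartesian_product card_PiE three)
  also have "\<dots> = (\<Prod>s\<le>K. m s * 3 ^ (3 * m s))" by (simp add: power_sum prod.distrib)
  finally have card_T: "card T = (\<Prod>s\<le>K. m s * 3 ^ (3 * m s))" .
  have "finite (lcosets (layer_kernel K)) \<and> card (lcosets (layer_kernel K)) \<le> card T"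
  proof (rule card_lcosets_le[OF layer_kernel_subgroup \<open>finite T\<close>])
    show "\<Phi> a \<in> T" for a using m_pos by (auto simp: \<Phi>_def T_def)
  next
    fix a b assume a: "a \<in> carrier G" and b: "b \<in> carrier G" and eq: "\<Phi> a = \<Phi> b"
    obtain \<tau> h where h: "\<And>s i c. \<rho> a (s, i, c) = (s, i + \<tau>, h s i c)"
      and h_per: "\<And>s i c T. div_m s T \<Longrightarrow> h s (i + T) c = h s i c" 
      using rho_perms[OF a] by (rule perms_form) blast
    obtain \<tau>' h' where h': "\<And>s i c. \<rho> b (s, i, c) = (s, i + \<tau>', h' s i c)"
      and h'_per: "\<And>s i c T. div_m s T \<Longrightarrow> h' s (i + T) c = h' s i c" 
      using rho_perms[OF b] by (rule perms_form) blast
    have div: "div_m s (\<tau>' - \<tau>)" if "s \<le> K" for s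
    proof -
      have "\<tau> mod int (m s) = \<tau>' mod int (m s)"
        using arg_cong[OF eq, of "\<lambda>x. fst x s"] that by (simp add: \<Phi>_def h h')
      then show ?thesis by (metis mod_eq_dvd_iff)
    qed
    have h_eq: "h s i c = h' s i c" if "s \<le> K" for s i c
    proof -
      define j where "j = i mod int (m s)"
      have "(s, j, c) \<in> \<Omega>" using that m_pos[of s] by (simp add: \<Omega>_def j_def)
      then have "h s j c = h' s j c"
        using arg_cong[OF eq, of "\<lambda>x. snd x (s, j, c)"] by (simp add: \<Phi>_def h h')
      moreover have "div_m s (i - j)" by (simp add: j_def minus_mod_eq_mult_div)
      ultimately show ?thesis using h_per[of s "i - j" j c] h'_per[of s "i - j" j c] by simp
    qed
    have "\<rho> (inv a \<otimes> b) (s, i, c) = (s, i + (\<tau>' - \<tau>), c)" if "s \<le> K" for s i c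
    proof -
      have "\<rho> b (s, i, c) = \<rho> a (s, i + (\<tau>' - \<tau>), c)"
        using h_per[OF div[OF that], of i c] h_eq[OF that] by (simp add: h h')
      then show ?thesis using fun_cong[OF rho_inv[OF a]] a b by (simp add: rho_mult)
    qed
    then show "inv a \<otimes> b \<in> layer_kernel K"
      using a b div by (intro layer_kernelI[of _ _ "\<tau>' - \<tau>"]) simp_all
  qed
  then show ?thesis by (simp add: card_T)
qed

lemma finite_index_layer_kernel: "finite_index G (layer_kernel K)"
  unfolding finite_index_def using layer_kernel_subgroup index_layer_kernel by blast

text \<open>Two elements of the ball in one coset differ by a word \<open>u\<close> of length at
  most \<open>2 * n\<close>, acting on the layers up to \<open>K\<close> as a shift by
  \<open>T\<close>. As \<open>T\<close> is a multiple of \<open>m K\<close> and smaller in absolute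
  value, it vanishes; \<open>eval_determined_by_layer\<close> with radius \<open>2 * n\<close>
  handles the higher layers.\<close>

lemma inj_on_word_ball:
  assumes "4 * n < 2 ^ K"
  shows "inj_on (\<lambda>a. a <# layer_kernel K) (word_ball G gens n)"
proof (rule inj_onI)
  fix a b assume "a \<in> word_ball G gens n" "b \<in> word_ball G gens n"
    and eq: "a <# layer_kernel K = b <# layer_kernel K"
  then obtain v w where a: "a \<in> carrier G" and b: "b \<in> carrier G"
    and v: "set v \<subseteq> letters" "length v \<le> n" "\<rho> a = eval v"
    and w: "set w \<subseteq> letters" "length w \<le> n" "\<rho> b = eval w"
    unfolding word_ball_iff by blast
  obtain v' where v': "set v' \<subseteq> letters" "length v' = length v" "eval v' \<circ> eval v = id"
    using v(1) by (rule eval_inverse)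
  have "\<rho> (inv a) = eval v'" by (rule rho_inv_unique_left[OF a]) (use v(3) v'(3) in simp)
  define u where "u = v' @ w"
  have u: "set u \<subseteq> letters" "length u \<le> 2 * n" using v v' w by (auto simp: u_def)
  have rho: "\<rho> (inv a \<otimes> b) = eval u"
    using a b w \<open>\<rho> (inv a) = eval v'\<close> by (simp add: rho_mult u_def eval_append)
  have "inv a \<otimes> b \<in> layer_kernel K" using lcos_eq_iff[OF layer_kernel_subgroup a b] eq by simp
  then obtain T where div: "\<And>s. s \<le> K \<Longrightarrow> div_m s T"
    and T: "\<And>s i c. s \<le> K \<Longrightarrow> eval u (s, i, c) = (s, i + T, c)"
    unfolding rho[symmetric] by (rule layer_kernelE) blast
  obtain \<tau> c' where "\<bar>\<tau>\<bar> \<le> int (length u)" "eval u (K, 0, 0) = (K, 0 + \<tau>, c')"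
    using eval_local[OF u, of K 0 K 0 0] by auto
  then have "\<bar>T\<bar> \<le> int (length u)" using T[of K 0 0] by auto
  moreover have "4 * int n < 2 ^ K"
    using assms by (metis of_nat_less_iff of_nat_mult of_nat_numeral of_nat_power)
  then have "int (length u) < int (m K)" using u(2) m_ge[of K] by simp
  ultimately have "T = 0" by (intro div_m_small[OF div[OF order_refl]]) linarith
  have "eval u = id"
  proof
    fix p :: point
    obtain s i c where p: "p = (s, i, c)" by (cases p) auto
    show "eval u p = id p"
    proof (cases "s \<le> K")
      case True
      then show ?thesis using T[OF True] \<open>T = 0\<close> p by simp
    next
      case False
      have "eval u (s, i, c) = (s, i, c)"
        by (rule eval_determined_by_layer[OF u, of K]) (use assms False T \<open>T = 0\<close> in auto)
      then show ?thesis using p by simp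
    qed
  qed
  then have "inv a \<otimes> b = \<one>" using rho rho_one rho_eq_iff a b by (metis inv_closed m_closed one_closed)
  then show "a = b" using a b by (metis inv_equality inv_inv inv_closed)
qed

lemma residually_finite: "residually_finite G"
  unfolding residually_finite_def
proof (intro ballI impI)
  fix a assume a: "a \<in> carrier G" "a \<noteq> \<one>"
  obtain n where n: "a \<in> word_ball G gens n" using a(1) by (rule in_some_word_ball)
  have one: "\<one> \<in> word_ball G gens n"
    unfolding word_ball_iff by (auto simp: rho_one intro!: exI[of _ "[]"])
  have "4 * n < 2 ^ (4 * n)" by (rule less_exp)
  then have "\<one> <# layer_kernel (4 * n) \<noteq> a <# layer_kernel (4 * n)"
    using inj_on_word_ball n one a(2) by (metis inj_onD)
  then have "a \<notin> layer_kernel (4 * n)"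
    using lcos_eq_iff[OF layer_kernel_subgroup one_closed a(1)] a(1) by simp
  then show "\<exists>H. finite_index G H \<and> a \<notin> H" using finite_index_layer_kernel by blast
qed

section \<open>Bounds for the full residual finiteness growth\<close>

lemma injectivity_radius_ge_iff:
  "enat n \<le> injectivity_radius G gens N \<longleftrightarrow> inj_on (\<lambda>a. a <# N) (word_ball G gens n)"
proof
  assume le: "enat n \<le> injectivity_radius G gens N"
  show "inj_on (\<lambda>a. a <# N) (word_ball G gens n)"
  proof (rule ccontr)
    assume not_inj: "\<not> ?thesis"
    have less: "k < n" if "inj_on (\<lambda>a. a <# N) (word_ball G gens k)" for k
      using that not_inj word_ball_mono inj_on_subset by (metis not_le)
    \<comment> \<open>The ball of radius \<open>0\<close> is a single point, so failure of
      injectivity forces \<open>n > 0\<close>; then \<open>n - 1\<close> lies strictly below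
      \<open>n\<close>.\<close>
    moreover have "word_ball G gens 0 = {\<one>}" by (auto simp: word_ball_def)
    then have "inj_on (\<lambda>a. a <# N) (word_ball G gens 0)" by simp
    ultimately have "n > 0" by blast
    have "injectivity_radius G gens N \<le> enat (n - 1)"
      unfolding injectivity_radius_def using less by (intro Sup_least) fastforce
    then have "n \<le> n - 1" using le order_trans enat_ord_simps(1) by blast
    then show False using \<open>n > 0\<close> by simp
  qed
next
  assume "inj_on (\<lambda>a. a <# N) (word_ball G gens n)"
  then show "enat n \<le> injectivity_radius G gens N"
    unfolding injectivity_radius_def by (auto intro: Sup_upper)
qed

lemma full_rf_growth_le:
  assumes "N \<lhd> G" "finite_index G N" "inj_on (\<lambda>a. a <# N) (word_ball G gens n)"
  shows "full_rf_growth G gens n \<le> card (lcosets N)"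
  unfolding full_rf_growth_def
  by (rule Least_le) (use assms injectivity_radius_ge_iff in blast)

lemma full_rf_growth_upper:
  assumes "4 * n < 2 ^ K"
  shows "full_rf_growth G gens n \<le> (\<Prod>s\<le>K. m s * 3 ^ (3 * m s))"
  using full_rf_growth_le[OF layer_kernel_normal finite_index_layer_kernel inj_on_word_ball[OF assms]]
    index_layer_kernel le_trans by blast

lemma full_rf_growth_lower:
  assumes "2 * 2 ^ s + 2 \<le> n"
  shows "3 ^ m s \<le> full_rf_growth G gens n"
proof -
  \<comment> \<open>The kernel on the layers up to \<open>4 * n\<close> is a candidate, so the least
    index is attained.\<close>
  have "4 * n < 2 ^ (4 * n)" by (rule less_exp)
  then have "\<exists>k N. N \<lhd> G \<and> finite_index G N \<and> enat n \<le> injectivity_radius G gens N \<and> k = card (lcosets N)"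
    using layer_kernel_normal finite_index_layer_kernel inj_on_word_ball injectivity_radius_ge_iff by blast
  from LeastI_ex[OF this] obtain N where "N \<lhd> G" "finite_index G N"
    "enat n \<le> injectivity_radius G gens N" "full_rf_growth G gens n = card (lcosets N)"
    unfolding full_rf_growth_def by blast
  then show ?thesis
    using card_lcosets_ge assms injectivity_radius_ge_iff unfolding finite_index_def by metis
qed

text \<open>At \<open>n = 0\<close> the exponent of the upper bound in the theorem is
  \<open>0\<close>, so the value there must be at most \<open>1\<close>; the whole group serves as
  subgroup.\<close>

lemma full_rf_growth_zero: "full_rf_growth G gens 0 \<le> 1"
proof -
  have "lcosets (carrier G) = {carrier G}"
    by (auto simp: LCOSETS_def coset_join3[OF _ subgroup_self])
  moreover have "carrier G \<lhd> G" by (simp add: normal_inv_iff subgroup_self)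
  moreover have "word_ball G gens 0 = {\<one>}" by (auto simp: word_ball_def)
  ultimately show ?thesis
    using full_rf_growth_le[of "carrier G" 0] by (simp add: finite_index_def subgroup_self)
qed

end

lemma group_with_layers:
  fixes m :: "nat \<Rightarrow> nat"
  assumes "\<And>s. m s > 0" "\<And>s. 2 ^ Suc s dvd m s"
  obtains G :: "nat monoid" and S where "group G" "residually_finite G" "finite S"
    "S \<subseteq> carrier G" "generate G S = carrier G" "full_rf_growth G S 0 \<le> 1"
    "\<And>n K. 4 * n < 2 ^ K \<Longrightarrow> full_rf_growth G S n \<le> (\<Prod>s\<le>K. m s * 3 ^ (3 * m s))"
    "\<And>n s. 2 * 2 ^ s + 2 \<le> n \<Longrightarrow> 3 ^ m s \<le> full_rf_growth G S n"
proof -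
  interpret layered_action m by unfold_locales (use assms in auto)
  obtain G :: "nat monoid" and \<rho> where G: "group G" "bij_betw \<rho> (carrier G) perms"
    "\<And>a b. a \<in> carrier G \<Longrightarrow> b \<in> carrier G \<Longrightarrow> \<rho> (a \<otimes>\<^bsub>G\<^esub> b) = \<rho> a \<circ> \<rho> b"
    by (rule countable_function_group[OF countable_perms id_perms comp_perms perms_inverse]) blast+
  interpret G: group G by fact
  interpret layered_group m G \<rho> by unfold_locales (use G in auto)
  show thesis
    by (rule that[of G gens]) (use G(1) residually_finite gens_carrier generate_gens
        full_rf_growth_zero full_rf_growth_upper full_rf_growth_lower in \<open>auto simp: gens_def\<close>)
qed

section \<open>Choice of the layers\<close>

lemma layer_sizes:
  fixes f :: "nat \<Rightarrow> nat"
  obtains m :: "nat \<Rightarrow> nat" where "\<And>s. m s > 0" "\<And>s. 2 ^ Suc s dvd m s" "\<And>s. f s \<le> 3 ^ m s"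
    "\<And>s. real (m s) \<le> ln (max 1 (real (f s))) + 1 + 2 * 2 ^ s"
proof -
  define L where "L s = nat \<lceil>log 3 (max 1 (real (f s)))\<rceil>" for s
  \<comment> \<open>This is the first multiple of \<open>2 ^ Suc s\<close> strictly above
    \<open>L s\<close>, hence positive even if \<open>L s = 0\<close>. The \<open>max 1\<close>
    keeps the logarithm nonnegative when \<open>f s = 0\<close>.\<close>
  define m where "m s = 2 ^ Suc s * (1 + L s div 2 ^ Suc s)" for s
  have m_eq: "m s = 2 ^ Suc s + (L s - L s mod 2 ^ Suc s)" for s
    by (simp only: m_def distrib_left mult_1_right minus_mod_eq_mult_div)
  have m_ge: "L s \<le> m s" and m_le: "m s \<le> 2 ^ Suc s + L s" for s
  proof -
    have "L s mod 2 ^ Suc s < 2 ^ Suc s" by (rule mod_less_divisor) simp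
    then show "L s \<le> m s" "m s \<le> 2 ^ Suc s + L s" unfolding m_eq[of s] by linarith+
  qed
  have log_nonneg: "0 \<le> log 3 (max 1 (real (f s)))" for s by simp
  have "f s \<le> 3 ^ m s" for s
  proof -
    have "real (f s) \<le> max 1 (real (f s))" by simp
    also have "\<dots> = 3 powr log 3 (max 1 (real (f s)))" by simp
    also have "\<dots> \<le> 3 powr real (m s)"
    proof (rule powr_mono)
      have "log 3 (max 1 (real (f s))) \<le> real (L s)" unfolding L_def by (rule real_nat_ceiling_ge)
      then show "log 3 (max 1 (real (f s))) \<le> real (m s)" using m_ge[of s] by linarith
    qed simp
    also have "\<dots> = real (3 ^ m s)" by (simp add: powr_realpow)
    finally show ?thesis by linarith
  qed
  moreover have "real (m s) \<le> ln (max 1 (real (f s))) + 1 + 2 * 2 ^ s" for s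
  proof -
    have "1 \<le> ln (3::real)" using exp_le by (simp add: ln_ge_iff)
    then have "log 3 (max 1 (real (f s))) \<le> ln (max 1 (real (f s)))"
      by (simp add: log_def divide_le_eq mult_le_cancel_left1)
    moreover have "real (L s) \<le> log 3 (max 1 (real (f s))) + 1"
      unfolding L_def using log_nonneg[of s] by linarith
    moreover have "real (m s) \<le> real (2 ^ Suc s + L s)" using m_le[of s] by (simp only: of_nat_le_iff)
    ultimately show ?thesis by simp
  qed
  ultimately show thesis by (intro that[of m]) (auto simp: m_def)
qed

section \<open>Estimating the product over the layers\<close>

lemma power_two_between:
  assumes "1 \<le> (x::nat)"
  obtains K where "x < 2 ^ K" "2 ^ K \<le> 2 * x"
proof -
  define K where "K = (LEAST K. x < 2 ^ K)"
  have "x < 2 ^ x" by (rule less_exp)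
  then have K: "x < 2 ^ K" unfolding K_def by (rule LeastI)
  then obtain k where k: "K = Suc k" using assms by (cases K) auto
  then have "\<not> x < 2 ^ k" using not_less_Least[of k "\<lambda>K. x < 2 ^ K"] by (simp add: K_def)
  then show thesis using that[of K] K k by simp
qed

text \<open>The factor \<open>m s\<close> is absorbed by \<open>3 ^ m s\<close>, so each layer
  contributes at most \<open>3 ^ (4 * m s)\<close>; with \<open>ln 3 \<le> 2\<close> this gives the
  constant \<open>8\<close>.\<close>

lemma layer_product_bound:
  assumes "\<And>s. s \<le> K \<Longrightarrow> real (m s) \<le> M"
  shows "real (\<Prod>s\<le>K. m s * 3 ^ (3 * m s)) \<le> exp (8 * (real K + 1) * M)"
proof -
  have "(\<Prod>s\<le>K. m s * 3 ^ (3 * m s)) \<le> (\<Prod>s\<le>K. 3 ^ (4 * m s) :: nat)"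
  proof (rule prod_mono)
    fix s
    have "m s \<le> 3 ^ m s" using less_exp[of "m s"] power_mono[of 2 "3::nat" "m s"] by simp
    then have "m s * 3 ^ (3 * m s) \<le> 3 ^ m s * 3 ^ (3 * m s)" by simp
    also have "\<dots> = 3 ^ (4 * m s)" by (simp add: power_add[symmetric])
    finally show "0 \<le> m s * 3 ^ (3 * m s) \<and> m s * 3 ^ (3 * m s) \<le> 3 ^ (4 * m s)" by simp
  qed
  also have "\<dots> = 3 ^ (\<Sum>s\<le>K. 4 * m s)" by (simp add: power_sum)
  finally have "real (\<Prod>s\<le>K. m s * 3 ^ (3 * m s)) \<le> real (3 ^ (\<Sum>s\<le>K. 4 * m s))"
    by (rule of_nat_mono)
  also have "\<dots> = exp (ln 3 * real (\<Sum>s\<le>K. 4 * m s))"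
    by (simp only: exp_of_nat2_mult exp_ln zero_less_numeral of_nat_power of_nat_numeral)
  also have "\<dots> \<le> exp (2 * (\<Sum>s\<le>K. 4 * M))"
  proof -
    have "real (\<Sum>s\<le>K. 4 * m s) \<le> (\<Sum>s\<le>K. 4 * M)"
      unfolding of_nat_sum by (intro sum_mono) (use assms in simp)
    moreover have "ln (3::real) \<le> 2" using ln_le_minus_one[of "3::real"] by simp
    ultimately have "ln 3 * real (\<Sum>s\<le>K. 4 * m s) \<le> 2 * (\<Sum>s\<le>K. 4 * M)"
      by (intro mult_mono) (auto intro: sum_nonneg)
    then show ?thesis by simp
  qed
  also have "2 * (\<Sum>s\<le>K. 4 * M) = 8 * (real K + 1) * M" by (simp add: algebra_simps)
  finally show ?thesis .
qed

text \<open>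
  Only logarithmically many layers are needed to separate the ball of radius \<open>n\<close>, so the
  product of their sizes is far below the admissible exponent \<open>2 * n\<close>.
\<close>

lemma layer_product_growth:
  fixes F :: "nat \<Rightarrow> nat"
  assumes "mono F" and "c > 0" and F: "\<And>n. n \<ge> n1 \<Longrightarrow> exp (c * real n) \<le> real (F n)"
    and m: "\<And>s. real (m s) \<le> ln (max 1 (real (F (2 ^ s)))) + 1 + 2 * 2 ^ s"
    and R: "\<And>n K. 4 * n < 2 ^ K \<Longrightarrow> R n \<le> (\<Prod>s\<le>K. m s * 3 ^ (3 * m s))"
  shows "\<forall>\<^sub>F n in sequentially. real (R n) \<le> real (F (8 * n)) powr (2 * real n)"
proof -
  \<comment> \<open>The \<open>8\<close> comes from \<open>layer_product_bound\<close>. The other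
    factor comes from \<open>m s \<le> l + 3 * 2 ^ K\<close> and \<open>2 ^ K \<le> l / c\<close>
    for \<open>s \<le> K\<close>, with \<open>l\<close> as defined below.\<close>
  define A where "A = 8 * (1 + 3 / c)"
  have "A > 0" using \<open>c > 0\<close> by (simp add: A_def add_pos_pos)
  have "(\<lambda>n. (log 2 (8 * real n) + 1) / real n) \<longlonglongrightarrow> 0" by real_asymp
  then have "\<forall>\<^sub>F n in sequentially. (log 2 (8 * real n) + 1) / real n < 2 / A"
    by (rule order_tendstoD) (use \<open>A > 0\<close> in simp)
  with eventually_ge_at_top[of "n1 + 1"] show ?thesis
  proof eventually_elim
    case (elim n)
    then have n: "1 \<le> n" "n1 \<le> n" by simp_all
    obtain K where K: "4 * n < 2 ^ K" "2 ^ K \<le> 2 * (4 * n)"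
      using power_two_between[of "4 * n"] n(1) by auto
    define l where "l = ln (real (F (2 ^ K)))"
    have F_ge: "exp (c * real (2 ^ K)) \<le> real (F (2 ^ K))" using F[of "2 ^ K"] K(1) n by simp
    have "1 \<le> exp (c * real (2 ^ K))" using \<open>c > 0\<close> by simp
    then have F_pos: "1 \<le> real (F (2 ^ K))" using F_ge by linarith
    have l_ge: "c * 2 ^ K \<le> l"
      unfolding l_def using F_ge F_pos by (subst ln_ge_iff) simp_all
    have "real (m s) \<le> (1 + 3 / c) * l" if "s \<le> K" for s
    proof -
      have pow: "(2::nat) ^ s \<le> 2 ^ K" "(2::real) ^ s \<le> 2 ^ K" using that by simp_all
      have "max 1 (real (F (2 ^ s))) \<le> real (F (2 ^ K))"
        using F_pos monoD[OF \<open>mono F\<close> pow(1)] by simp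
      then have "ln (max 1 (real (F (2 ^ s)))) \<le> l" unfolding l_def by simp
      moreover have "1 \<le> (2::real) ^ K" by simp
      then have "1 + 2 * 2 ^ s \<le> 3 * (2::real) ^ K" using pow(2) by linarith
      moreover have "3 * 2 ^ K \<le> 3 / c * l" using l_ge \<open>c > 0\<close> by (simp add: field_simps)
      ultimately show ?thesis using m[of s] by (simp add: distrib_right)
    qed
    then have "real (\<Prod>s\<le>K. m s * 3 ^ (3 * m s)) \<le> exp (8 * (real K + 1) * ((1 + 3 / c) * l))"
      by (rule layer_product_bound)
    also have "8 * (real K + 1) * ((1 + 3 / c) * l) = A * (real K + 1) * l"
      unfolding A_def by (simp only: mult_ac)
    finally have "real (R n) \<le> exp (A * (real K + 1) * l)"
      using R[OF K(1)] by (meson of_nat_le_iff order_trans)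
    also have "\<dots> \<le> exp (2 * real n * l)"
    proof -
      have "real K = log 2 (real (2 ^ K))" by (simp add: log_nat_power)
      also have "\<dots> \<le> log 2 (8 * real n)"
      proof (subst log_le_cancel_iff)
        show "real (2 ^ K) \<le> 8 * real n" using of_nat_mono[OF K(2), where 'a = real] by simp
      qed (use n in simp_all)
      finally have "real K \<le> log 2 (8 * real n)" .
      then have "(real K + 1) / real n \<le> (log 2 (8 * real n) + 1) / real n"
        by (intro divide_right_mono add_right_mono) simp_all
      then have "(real K + 1) / real n \<le> 2 / A" using elim(2) by linarith
      then have "A * (real K + 1) \<le> 2 * real n"
        using \<open>A > 0\<close> n(1) by (simp add: field_simps)
      moreover have "l \<ge> 0" unfolding l_def using F_pos by simp
      ultimately show ?thesis by (simp add: mult_right_mono)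
    qed
    also have "\<dots> = real (F (2 ^ K)) powr (2 * real n)"
      using F_pos by (simp add: powr_def l_def)
    also have "\<dots> \<le> real (F (8 * n)) powr (2 * real n)"
      using monoD[OF \<open>mono F\<close>, of "2 ^ K" "8 * n"] K(2) by (intro powr_mono2) auto
    finally show ?case .
  qed
qed

section \<open>Growth of \<open>F\<close>, the constants, and the bounds for every
  \<open>n\<close>\<close>

text \<open>Once \<open>ln n\<close> and \<open>ln (ln n)\<close> are at least \<open>1\<close>, the
  logarithmic factors in the exponent are at least \<open>1\<close>.\<close>

lemma exponential_lower_bound:
  fixes F :: "nat \<Rightarrow> nat"
  assumes "c > 0" "\<epsilon> > 0" and F: "\<forall>n\<ge>3. real (F n) \<ge>
      exp (c * real n * (ln (real n))\<^sup>2 * (ln (ln (real n))) powr (1 + \<epsilon>))"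
  shows "\<forall>\<^sub>F n in sequentially. exp (c * real n) \<le> real (F n)"
proof -
  have "\<forall>\<^sub>F n in sequentially. ln (real n) \<ge> 1" by real_asymp
  moreover have "\<forall>\<^sub>F n in sequentially. ln (ln (real n)) \<ge> 1" by real_asymp
  ultimately show ?thesis using eventually_ge_at_top[of 3]
  proof eventually_elim
    case (elim n)
    have "1 \<le> (ln (real n))\<^sup>2" using elim(1) by (rule one_le_power)
    moreover have "1 \<le> (ln (ln (real n))) powr (1 + \<epsilon>)"
      using elim(2) \<open>\<epsilon> > 0\<close> by (intro ge_one_powr_ge_zero) auto
    ultimately have "1 \<le> (ln (real n))\<^sup>2 * (ln (ln (real n))) powr (1 + \<epsilon>)"
      using mult_mono[of 1 "(ln (real n))\<^sup>2" 1] by simp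
    then have "c * real n * 1 \<le> c * real n * ((ln (real n))\<^sup>2 * (ln (ln (real n))) powr (1 + \<epsilon>))"
      using \<open>c > 0\<close> by (intro mult_left_mono) auto
    then have "exp (c * real n) \<le> exp (c * real n * (ln (real n))\<^sup>2 * (ln (ln (real n))) powr (1 + \<epsilon>))"
      by (simp add: mult.assoc)
    then show ?case using F elim(3) by (meson order_trans)
  qed
qed

theorem theorem3p10:
  fixes F :: "nat \<Rightarrow> nat"
  assumes "mono F"
    and "\<exists>c \<epsilon> :: real. c > 0 \<and> \<epsilon> > 0 \<and>
           (\<forall>n\<ge>3. real (F n) \<ge>
              exp (c * real n * (ln (real n))\<^sup>2 * (ln (ln (real n))) powr (1 + \<epsilon>)))"
  shows "\<exists>(G :: nat monoid) (S :: nat set) (c1 :: real) (c2 :: real) (c3 :: real).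
           group G \<and> residually_finite G \<and>
           finite S \<and> S \<subseteq> carrier G \<and> generate G S = carrier G \<and>
           c1 > 1 \<and> c2 > 1 \<and> c3 > 1 \<and>
           (\<forall>n :: nat.
              (real n / c1 - c2 \<ge> 0 \<longrightarrow>
                 real (at_real F (real n / c1 - c2))
                     powr (1 - c3 * (ln (ln (ln (real (F n)))) / ln (ln (real (F n)))))
                   \<le> real (full_rf_growth G S n)) \<and>
              (F n \<ge> 3 \<longrightarrow>
                 real (full_rf_growth G S n)
                   \<le> real (at_real F (c1 * real n + c2))
                        powr ((2 + c3 * (ln (real n) / ln (ln (real (F n))))) * real n)))"
proof -
  from assms(2) obtain c \<epsilon> :: real where c: "c > 0"
    and ev: "\<forall>\<^sub>F n in sequentially. exp (c * real n) \<le> real (F n)"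
    using exponential_lower_bound by blast
  obtain n1 where n1: "\<And>n. n \<ge> n1 \<Longrightarrow> exp (c * real n) \<le> real (F n)"
    using ev by (auto simp: eventually_sequentially)
  obtain m where m: "\<And>s. m s > 0" "\<And>s. 2 ^ Suc s dvd m s" "\<And>s. F (2 ^ s) \<le> 3 ^ m s"
    "\<And>s. real (m s) \<le> ln (max 1 (real (F (2 ^ s)))) + 1 + 2 * 2 ^ s"
    using layer_sizes[of "\<lambda>s. F (2 ^ s)"] by blast
  obtain G :: "nat monoid" and S where G: "group G" "residually_finite G" "finite S"
    "S \<subseteq> carrier G" "generate G S = carrier G" and zero: "full_rf_growth G S 0 \<le> 1"
    and upper: "\<And>n K. 4 * n < 2 ^ K \<Longrightarrow> full_rf_growth G S n \<le> (\<Prod>s\<le>K. m s * 3 ^ (3 * m s))"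
    and lower: "\<And>n s. 2 * 2 ^ s + 2 \<le> n \<Longrightarrow> 3 ^ m s \<le> full_rf_growth G S n"
    using m(1,2) by (rule group_with_layers) blast
  define R where "R = full_rf_growth G S"
  obtain n0 where n0: "\<And>n. n \<ge> n0 \<Longrightarrow> real (R n) \<le> real (F (8 * n)) powr (2 * real n)"
  proof -
    have "\<forall>\<^sub>F n in sequentially. real (R n) \<le> real (F (8 * n)) powr (2 * real n)"
      unfolding R_def
      by (rule layer_product_growth[OF \<open>mono F\<close> c]) (erule n1, rule m(4), erule upper)
    then obtain N where "\<forall>n\<ge>N. real (R n) \<le> real (F (8 * n)) powr (2 * real n)"
      unfolding eventually_sequentially by blast
    then show thesis by (intro that[of N]) simp
  qed
  \<comment> \<open>With \<open>F Q \<ge> M\<close>, the additive constant \<open>Q\<close> absorbs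
    the finitely many \<open>n < n0\<close> in the upper bound and ensures
    \<open>ln (ln (F n)) \<ge> 1\<close> for all \<open>n \<ge> Q\<close>.\<close>
  define M where "M = exp (exp 1) + real (\<Sum>n<n0. R n)"
  have "filterlim (\<lambda>n. exp (c * real n)) at_top sequentially" using c by real_asymp
  then have "\<forall>\<^sub>F n in sequentially. M \<le> exp (c * real n)" by (simp add: filterlim_at_top)
  with ev eventually_ge_at_top[of 2] have "\<forall>\<^sub>F n in sequentially. 2 \<le> n \<and> M \<le> real (F n)"
    by eventually_elim auto
  then obtain Q where Q: "2 \<le> Q" "M \<le> real (F Q)"
    by (auto simp: eventually_sequentially)
  have M: "exp (exp 1) \<le> M" "\<And>n. n < n0 \<Longrightarrow> real (R n) \<le> M"
  proof -
    show "exp (exp 1) \<le> M" unfolding M_def by linarith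
    fix n assume "n < n0"
    then have "R n \<le> (\<Sum>n<n0. R n)" by (intro member_le_sum) auto
    then have "real (R n) \<le> real (\<Sum>n<n0. R n)" by (rule of_nat_mono)
    then show "real (R n) \<le> M" unfolding M_def using exp_gt_zero[of "exp 1 :: real"] by linarith
  qed
  have one: "1 \<le> exp (exp (1::real))" by simp
  have "real (at_real F (real n / 16 - real Q))
      powr (1 - 2 * (ln (ln (ln (real (F n)))) / ln (ln (real (F n))))) \<le> real (R n)"
    if nonneg: "real n / 16 - real Q \<ge> 0" for n
  proof -
    have n: "16 * Q \<le> n" using nonneg by simp
    \<comment> \<open>Taking \<open>s = K - 1\<close> gives
      \<open>2 ^ s \<le> (n - 2) div 2 < 2 * 2 ^ s\<close>: the ball of radius \<open>n\<close>
      contains the words needed on layer \<open>s\<close>, while \<open>n / 16\<close> does not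
      exceed \<open>2 ^ s\<close>.\<close>
    have half: "1 \<le> (n - 2) div 2" using n Q(1) by linarith
    then obtain K where K: "(n - 2) div 2 < 2 ^ K" "2 ^ K \<le> 2 * ((n - 2) div 2)"
      by (rule power_two_between)
    then obtain s where s: "K = Suc s" using half by (cases K) auto
    have s_le: "2 * 2 ^ s + 2 \<le> n" and "n \<le> 16 * 2 ^ s"
      using K n Q(1) unfolding s power_Suc by linarith+
    then have "real n \<le> 16 * 2 ^ s" by (metis of_nat_le_iff of_nat_mult of_nat_numeral of_nat_power)
    then have "nat \<lceil>real n / 16 - real Q\<rceil> \<le> 2 ^ s" by (simp add: nat_le_iff ceiling_le_iff)
    then have "at_real F (real n / 16 - real Q) \<le> F (2 ^ s)"
      unfolding at_real_def by (rule monoD[OF \<open>mono F\<close>])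
    also have "\<dots> \<le> R n" using m(3)[of s] lower[OF s_le] by (simp add: R_def)
    finally have le: "at_real F (real n / 16 - real Q) \<le> R n" .
    have "Q \<le> n" using n by simp
    then have "exp (exp 1) \<le> real (F n)"
      using M(1) Q(2) monoD[OF \<open>mono F\<close>, of Q n] by (meson of_nat_mono order_trans)
    then have "exp 1 \<le> ln (real (F n))" by (subst ln_ge_iff) (use one in linarith)+
    then have "1 \<le> ln (ln (real (F n)))" by (subst ln_ge_iff) (use one_le_exp_iff[of "1::real"] in linarith)+
    then have exponent: "1 - 2 * (ln (ln (ln (real (F n)))) / ln (ln (real (F n)))) \<le> 1" by simp
    show ?thesis
    \<comment> \<open>If the base is \<open>0\<close>, then so is its \<open>powr\<close>; otherwise
      it is at least \<open>1\<close> and the exponent may be raised to \<open>1\<close>.\<close>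
    proof (cases "at_real F (real n / 16 - real Q) = 0")
      case False
      then have "real (at_real F (real n / 16 - real Q))
          powr (1 - 2 * (ln (ln (ln (real (F n)))) / ln (ln (real (F n)))))
          \<le> real (at_real F (real n / 16 - real Q)) powr 1"
        by (intro powr_mono exponent) simp
      then show ?thesis using le by simp
    qed simp
  qed
  moreover have "real (R n) \<le> real (at_real F (16 * real n + real Q))
      powr ((2 + 2 * (ln (real n) / ln (ln (real (F n))))) * real n)" if "F n \<ge> 3" for n
  proof -
    define b where "b = real (at_real F (16 * real n + real Q))"
    define e where "e = (2 + 2 * (ln (real n) / ln (ln (real (F n))))) * real n"
    have "nat \<lceil>16 * real n + real Q\<rceil> = 16 * n + Q"
      by (metis ceiling_of_nat nat_int of_nat_add of_nat_mult of_nat_numeral)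
    then have b: "b = real (F (16 * n + Q))" by (simp add: b_def at_real_def)
    then have b_ge: "real (F Q) \<le> b" "real (F (8 * n)) \<le> b"
      using monoD[OF \<open>mono F\<close>, of Q "16 * n + Q"] monoD[OF \<open>mono F\<close>, of "8 * n" "16 * n + Q"] by simp_all
    have "1 \<le> b" using one M(1) Q(2) b_ge(1) by linarith
    show ?thesis
    proof (cases "n = 0")
      case True
      then show ?thesis using zero \<open>1 \<le> b\<close> by (simp add: R_def b_def)
    next
      case False
      \<comment> \<open>Here \<open>F n \<ge> 3\<close> exceeds Euler's number, so the iterated
        logarithm and the quotient are nonnegative, and the exponent is at least
        \<open>2 * n\<close>.\<close>
      have "exp 1 \<le> real (F n)" using exp_le that by linarith
      then have "1 \<le> ln (real (F n))" using that by (subst ln_ge_iff) auto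
      then have "0 \<le> ln (ln (real (F n)))" by simp
      then have "0 \<le> ln (real n) / ln (ln (real (F n)))" using False by (intro divide_nonneg_nonneg) auto
      then have e: "2 * real n \<le> e" unfolding e_def by (intro mult_right_mono) auto
      have "real (R n) \<le> b powr e"
      \<comment> \<open>For small \<open>n\<close> the base \<open>b \<ge> F Q \<ge> M\<close> alone
        dominates \<open>R n\<close>, as the exponent is at least \<open>1\<close>; for the others
        \<open>layer_product_growth\<close> applies.\<close>
      proof (cases "n < n0")
        case True
        have "1 \<le> e" using e False by linarith
        have "real (R n) \<le> b powr 1" using M(2)[OF True] Q(2) b_ge(1) \<open>1 \<le> b\<close> by simp
        also have "\<dots> \<le> b powr e" using \<open>1 \<le> e\<close> \<open>1 \<le> b\<close> by (rule powr_mono)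
        finally show ?thesis .
      next
        case False
        then have "real (R n) \<le> real (F (8 * n)) powr (2 * real n)" by (intro n0) simp
        also have "\<dots> \<le> b powr (2 * real n)" using b_ge(2) by (intro powr_mono2) auto
        also have "\<dots> \<le> b powr e" using e \<open>1 \<le> b\<close> by (rule powr_mono)
        finally show ?thesis .
      qed
      then show ?thesis by (simp add: b_def e_def)
    qed
  qed
  ultimately show ?thesis
    using G Q(1) unfolding R_def
    by (intro exI[of _ G] exI[of _ S] exI[of _ 16] exI[of _ "real Q"] exI[of _ 2]) auto
qed

end
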